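(* Let $\alpha\in\mathbb{C}\setminus\{0,-1\}$ and $\lambda\in\mathbb{C}$. The representation $\pi_\lambda$ of $D(2,1;\alpha)$ on $S(\mathbb{C}^{2|2})=\mathbb{C}[x,y]\otimes\Lambda(\theta,\eta)$ is irreducible if and only if $$\lambda\notin\mathbb{N}\quad\text{and}\quad\lambda/\alpha\notin\mathbb{N}.$$ If either $\lambda\in\mathbb{N}$ or $\lambda/\alpha\in\mathbb{N}$, the representation is indecomposable but not irreducible.
   Context: $\mathbb{N}=\{0,1,2,\dots\}$; the ground field is $\mathbb{C}$; $x,y$ are even and $\theta,\eta$ odd. $D(2,1;\alpha)$ ($\alpha\ne0,-1$) is the simple Lie superalgebra of dimension $9|8$ with even roots $\{\pm2\delta_1,\pm2\delta_2,\pm2\delta_3\}$, odd roots $\{\pm\delta_1\pm\delta_2\pm\delta_3\}$, and Cartan matrix $\begin{pmatrix}2&-1&0\\-1&0&-\alpha\\0&-1&2\end{pmatrix}$ with respect to the simple roots $2\delta_2,\ \delta_1-\delta_2-\delta_3,\ 2\delta_3$. A basis is given by $H_{\delta_1},H_{\delta_2},H_{\delta_3}$ (basis of the Cartan subalgebra with $\delta_i(H_{\delta_j})=\delta_{ij}$) and root vectors $X_\gamma$, normalised such that $[X_{2\delta_2},X_{-2\delta_2}]=H_{\delta_2}$, $[X_{2\delta_3},X_{-2\delta_3}]=H_{\delta_3}$, $[X_{\delta_1-\delta_2-\delta_3},X_{-\delta_1+\delta_2+\delta_3}]=-\frac{1+\alpha}2H_{\delta_1}-\frac12H_{\delta_2}-\frac\alpha2H_{\delta_3}$.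 The representation $\pi_\lambda$ is given by the following differential operators. On $\mathfrak{g}_-$: $\pi_\lambda(X_{-2\delta_3})=x$, $\pi_\lambda(X_{-2\delta_2})=y$, $\pi_\lambda(X_{\delta_1-\delta_2-\delta_3})=\theta$, $\pi_\lambda(X_{-\delta_1-\delta_2-\delta_3})=\eta$. On $\mathfrak{g}_0$: $\pi_\lambda(H_{\delta_1})=\theta\partial_\theta-\eta\partial_\eta$, $\pi_\lambda(H_{\delta_2})=\lambda-2y\partial_y-\theta\partial_\theta-\eta\partial_\eta$, $\pi_\lambda(H_{\delta_3})=\frac\lambda\alpha-2x\partial_x-\theta\partial_\theta-\eta\partial_\eta$, $\pi_\lambda(X_{2\delta_1})=(1+\alpha)\theta\partial_\eta$, $\pi_\lambda(X_{-2\delta_1})=(1+\alpha)\eta\partial_\theta$, $\pi_\lambda(X_{-\delta_1+\delta_2-\delta_3})=-\eta\partial_y-\alpha x\partial_\theta$, $\pi_\lambda(X_{\delta_1-\delta_2+\delta_3})=\theta\partial_x-y\partial_\eta$, $\pi_\lambda(X_{\delta_1+\delta_2-\delta_3})=\theta\partial_y-\alpha x\partial_\eta$, $\pi_\lambda(X_{-\delta_1-\delta_2+\delta_3})=-\eta\partial_x-y\partial_\theta$. On $\mathfrak{g}_+$: $\pi_\lambda(X_{2\delta_3})=\left(\frac\lambda\alpha-x\partial_x-\theta\partial_\theta-\eta\partial_\eta\right)\partial_x+y\partial_\eta\partial_\theta$, $\pi_\lambda(X_{2\delta_2})=\left(\lambda-y\partial_y-\theta\partial_\theta-\eta\partial_\eta\right)\partial_y+\alpha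 x\partial_\eta\partial_\theta$, $\pi_\lambda(X_{-\delta_1+\delta_2+\delta_3})=\left(-\lambda+\alpha x\partial_x+y\partial_y+(1+\alpha)\eta\partial_\eta\right)\partial_\theta+\eta\partial_x\partial_y$, $\pi_\lambda(X_{\delta_1+\delta_2+\delta_3})=\left(\lambda-\alpha x\partial_x-y\partial_y-(1+\alpha)\theta\partial_\theta\right)\partial_\eta+\theta\partial_x\partial_y$. *)

theory Defs
  imports "HOL-Analysis.Cartesian_Space" "HOL-Library.Poly_Mapping"
begin

section \<open>Complex Lie superalgebras and their representations\<close>

text \<open>Parities are booleans, \<^term>\<open>True\<close> being odd, so that parities add by \<open>\<noteq>\<close> and
  the product of two parities is their conjunction. A grading of a space \<open>'v\<close> is the family
  of its homogeneous parts, \<open>V False\<close> (even) and \<open>V True\<close> (odd).\<close>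

definition ksign :: "bool \<Rightarrow> complex" where
  "ksign p = (if p then - 1 else 1)"

definition super_vector_space ::
    "(complex \<Rightarrow> 'v \<Rightarrow> 'v::ab_group_add) \<Rightarrow> (bool \<Rightarrow> 'v set) \<Rightarrow> bool" where
  "super_vector_space scl V \<longleftrightarrow>
     vector_space scl \<and> (\<forall>p. module.subspace scl (V p)) \<and>
     V False \<inter> V True = {0} \<and> (\<forall>v. \<exists>v0 \<in> V False. \<exists>v1 \<in> V True. v = v0 + v1)"

definition lie_superalgebra ::
    "(complex \<Rightarrow> 'g \<Rightarrow> 'g::ab_group_add) \<Rightarrow> (bool \<Rightarrow> 'g set) \<Rightarrow> ('g \<Rightarrow> 'g \<Rightarrow> 'g) \<Rightarrow> bool" where
  "lie_superalgebra scl G br \<longleftrightarrow>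
     super_vector_space scl G \<and>
     (\<forall>a. Vector_Spaces.linear scl scl (br a)) \<and>
     (\<forall>b. Vector_Spaces.linear scl scl (\<lambda>a. br a b)) \<and>
     (\<forall>p q. \<forall>a \<in> G p. \<forall>b \<in> G q.
        br a b \<in> G (p \<noteq> q) \<and>
        br a b = scl (- ksign (p \<and> q)) (br b a) \<and>
        (\<forall>c. br a (br b c) = br (br a b) c + scl (ksign (p \<and> q)) (br b (br a c))))"

definition super_representation ::
    "(complex \<Rightarrow> 'g \<Rightarrow> 'g::ab_group_add) \<Rightarrow> (bool \<Rightarrow> 'g set) \<Rightarrow> ('g \<Rightarrow> 'g \<Rightarrow> 'g) \<Rightarrow>
     (complex \<Rightarrow> 'v \<Rightarrow> 'v::ab_group_add) \<Rightarrow> (bool \<Rightarrow> 'v set) \<Rightarrow> ('g \<Rightarrow> 'v \<Rightarrow> 'v) \<Rightarrow> bool" where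
  "super_representation sclG G br sclV V \<pi> \<longleftrightarrow>
     lie_superalgebra sclG G br \<and> super_vector_space sclV V \<and>
     (\<forall>a. Vector_Spaces.linear sclV sclV (\<pi> a)) \<and>
     (\<forall>v. Vector_Spaces.linear sclG sclV (\<lambda>a. \<pi> a v)) \<and>
     (\<forall>p q. \<forall>a \<in> G p. \<forall>v \<in> V q. \<pi> a v \<in> V (p \<noteq> q)) \<and>
     (\<forall>p q. \<forall>a \<in> G p. \<forall>b \<in> G q. \<forall>v.
        \<pi> (br a b) v = \<pi> a (\<pi> b v) - sclV (ksign (p \<and> q)) (\<pi> b (\<pi> a v)))"

text \<open>Submodules of a super representation are \<open>\<int>/2\<close>-graded.\<close>

definition graded_submodule ::
    "(complex \<Rightarrow> 'v \<Rightarrow> 'v::ab_group_add) \<Rightarrow> (bool \<Rightarrow> 'v set) \<Rightarrow> ('g \<Rightarrow> 'v \<Rightarrow> 'v) \<Rightarrow> 'v set \<Rightarrow> bool" where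
  "graded_submodule scl V \<pi> W \<longleftrightarrow>
     module.subspace scl W \<and>
     (\<forall>w \<in> W. \<exists>w0 \<in> W \<inter> V False. \<exists>w1 \<in> W \<inter> V True. w = w0 + w1) \<and>
     (\<forall>a. \<forall>w \<in> W. \<pi> a w \<in> W)"

definition irreducible_rep ::
    "(complex \<Rightarrow> 'g \<Rightarrow> 'g::ab_group_add) \<Rightarrow> (bool \<Rightarrow> 'g set) \<Rightarrow> ('g \<Rightarrow> 'g \<Rightarrow> 'g) \<Rightarrow>
     (complex \<Rightarrow> 'v \<Rightarrow> 'v::ab_group_add) \<Rightarrow> (bool \<Rightarrow> 'v set) \<Rightarrow> ('g \<Rightarrow> 'v \<Rightarrow> 'v) \<Rightarrow> bool" where
  "irreducible_rep sclG G br sclV V \<pi> \<longleftrightarrow>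
     super_representation sclG G br sclV V \<pi> \<and> (\<exists>v::'v. v \<noteq> 0) \<and>
     (\<forall>W. graded_submodule sclV V \<pi> W \<longrightarrow> W = {0} \<or> W = UNIV)"

definition indecomposable_rep ::
    "(complex \<Rightarrow> 'g \<Rightarrow> 'g::ab_group_add) \<Rightarrow> (bool \<Rightarrow> 'g set) \<Rightarrow> ('g \<Rightarrow> 'g \<Rightarrow> 'g) \<Rightarrow>
     (complex \<Rightarrow> 'v \<Rightarrow> 'v::ab_group_add) \<Rightarrow> (bool \<Rightarrow> 'v set) \<Rightarrow> ('g \<Rightarrow> 'v \<Rightarrow> 'v) \<Rightarrow> bool" where
  "indecomposable_rep sclG G br sclV V \<pi> \<longleftrightarrow>
     super_representation sclG G br sclV V \<pi> \<and> (\<exists>v::'v. v \<noteq> 0) \<and>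
     (\<forall>W1 W2. graded_submodule sclV V \<pi> W1 \<longrightarrow> graded_submodule sclV V \<pi> W2 \<longrightarrow>
        W1 \<inter> W2 = {0} \<longrightarrow> (\<forall>v. \<exists>w1 \<in> W1. \<exists>w2 \<in> W2. v = w1 + w2) \<longrightarrow>
        W1 = {0} \<or> W2 = {0})"


section \<open>The Lie superalgebra $D(2,1;\alpha)$\<close>

datatype coord = D1 | D2 | D3
datatype sign = Plus | Minus

primrec sg :: "sign \<Rightarrow> complex" where
  "sg Plus = 1"
| "sg Minus = - 1"

text \<open>\<open>H i\<close> is $H_{\delta_i}$, \<open>Xe i s\<close> is the even root vector $X_{2 s\delta_i}$, and
  \<open>Xo s1 s2 s3\<close> is the odd root vector $X_{s_1\delta_1+s_2\delta_2+s_3\delta_3}$.\<close>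

datatype D21_basis = H coord | Xe coord sign | Xo sign sign sign

lemma UNIV_D21_basis:
  "UNIV = {H D1, H D2, H D3, Xe D1 Plus, Xe D1 Minus, Xe D2 Plus, Xe D2 Minus, Xe D3 Plus,
     Xe D3 Minus, Xo Plus Plus Plus, Xo Plus Plus Minus, Xo Plus Minus Plus,
     Xo Plus Minus Minus, Xo Minus Plus Plus, Xo Minus Plus Minus, Xo Minus Minus Plus,
     Xo Minus Minus Minus}" (is "_ = ?S")
proof -
  have "b \<in> ?S" for b
  proof (cases b)
    case (H i) then show ?thesis by (cases i) simp_all
  next
    case (Xe i s) then show ?thesis by (cases i; cases s) simp_all
  next
    case (Xo r s t) then show ?thesis by (cases r; cases s; cases t) simp_all
  qed
  then show ?thesis by (rule UNIV_eq_I)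
qed

instance D21_basis :: finite
  by standard (unfold UNIV_D21_basis, intro finite.intros)

fun odd_basis :: "D21_basis \<Rightarrow> bool" where
  "odd_basis (Xo _ _ _) = True"
| "odd_basis _ = False"

text \<open>\<open>weight b i\<close> is the value on $H_{\delta_i}$ of the root of \<open>b\<close>
  (and \<open>0\<close> for \<open>b\<close> in the Cartan subalgebra).\<close>

fun weight :: "D21_basis \<Rightarrow> coord \<Rightarrow> complex" where
  "weight (H _) _ = 0"
| "weight (Xe i s) j = (if i = j then 2 * sg s else 0)"
| "weight (Xo s1 s2 s3) D1 = sg s1"
| "weight (Xo s1 s2 s3) D2 = sg s2"
| "weight (Xo s1 s2 s3) D3 = sg s3"

type_synonym D21 = "complex ^ D21_basis"

abbreviation basis_vec :: "D21_basis \<Rightarrow> D21" where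
  "basis_vec b \<equiv> axis b 1"

text \<open>The action of the even root vectors on the odd part, and the structure constants. The
  three prescribed normalisations do not fix all root vectors; the remaining scalars are those
  for which the operators of \<open>pi_basis\<close> below satisfy the bracket relations.\<close>

fun ad_even_odd :: "complex \<Rightarrow> coord \<Rightarrow> sign \<Rightarrow> sign \<Rightarrow> sign \<Rightarrow> sign \<Rightarrow> D21" where
  "ad_even_odd \<alpha> D1 s s1 s2 s3 =
     (if s1 = s then 0 else ((1 + \<alpha>) * sg s2 * sg s3) *s basis_vec (Xo s s2 s3))"
| "ad_even_odd \<alpha> D2 s s1 s2 s3 =
     (if s2 = s then 0 else (- sg s1) *s basis_vec (Xo s1 s s3))"
| "ad_even_odd \<alpha> D3 s s1 s2 s3 =
     (if s3 = s then 0 else (- sg s1) *s basis_vec (Xo s1 s2 s))"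

fun D21_bracket_basis :: "complex \<Rightarrow> D21_basis \<Rightarrow> D21_basis \<Rightarrow> D21" where
  "D21_bracket_basis \<alpha> (H i) b = weight b i *s basis_vec b"
| "D21_bracket_basis \<alpha> (Xe i s) (H j) = (- weight (Xe i s) j) *s basis_vec (Xe i s)"
| "D21_bracket_basis \<alpha> (Xo s1 s2 s3) (H j) =
     (- weight (Xo s1 s2 s3) j) *s basis_vec (Xo s1 s2 s3)"
| "D21_bracket_basis \<alpha> (Xe i s) (Xe j t) =
     (if i = j \<and> s \<noteq> t
      then (sg s * (if i = D1 then (1 + \<alpha>)\<^sup>2 else 1)) *s basis_vec (H i) else 0)"
| "D21_bracket_basis \<alpha> (Xe i s) (Xo s1 s2 s3) = ad_even_odd \<alpha> i s s1 s2 s3"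
| "D21_bracket_basis \<alpha> (Xo s1 s2 s3) (Xe i s) = - ad_even_odd \<alpha> i s s1 s2 s3"
| "D21_bracket_basis \<alpha> (Xo s1 s2 s3) (Xo t1 t2 t3) =
     (if s1 \<noteq> t1 \<and> s2 \<noteq> t2 \<and> s3 \<noteq> t3 then
        (- ((1 + \<alpha>) / 2)) *s basis_vec (H D1) + (sg s1 * sg s2 / 2) *s basis_vec (H D2)
        + (\<alpha> * sg s1 * sg s3 / 2) *s basis_vec (H D3)
      else if s1 = t1 \<and> s2 \<noteq> t2 \<and> s3 \<noteq> t3 then (sg s1 * sg s2 * sg s3) *s basis_vec (Xe D1 s1)
      else if s1 \<noteq> t1 \<and> s2 = t2 \<and> s3 \<noteq> t3 then (- 1) *s basis_vec (Xe D2 s2)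
      else if s1 \<noteq> t1 \<and> s2 \<noteq> t2 \<and> s3 = t3 then (- \<alpha>) *s basis_vec (Xe D3 s3)
      else 0)"

definition D21_bracket :: "complex \<Rightarrow> D21 \<Rightarrow> D21 \<Rightarrow> D21" where
  "D21_bracket \<alpha> u v =
     (\<Sum>a\<in>UNIV. \<Sum>b\<in>UNIV. (u $ a * v $ b) *s D21_bracket_basis \<alpha> a b)"

definition D21_part :: "bool \<Rightarrow> D21 set" where
  "D21_part p = {u. \<forall>b. u $ b \<noteq> 0 \<longrightarrow> odd_basis b = p}"


subsection \<open>Lie superalgebra axioms, normalisation, Cartan matrix and simplicity\<close>

lemma D21_bracket_add_left: "D21_bracket \<alpha> (u + v) w = D21_bracket \<alpha> u w + D21_bracket \<alpha> v w"
  by (simp add: D21_bracket_def sum.distrib[symmetric] algebra_simps vec.scale_left_distrib)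

lemma D21_bracket_add_right: "D21_bracket \<alpha> w (u + v) = D21_bracket \<alpha> w u + D21_bracket \<alpha> w v"
  by (simp add: D21_bracket_def sum.distrib[symmetric] algebra_simps vec.scale_left_distrib)

lemma D21_bracket_scale_left: "D21_bracket \<alpha> (k *s u) w = k *s D21_bracket \<alpha> u w"
  by (simp add: D21_bracket_def vec.scale_sum_right mult.assoc)

lemma D21_bracket_scale_right: "D21_bracket \<alpha> w (k *s u) = k *s D21_bracket \<alpha> w u"
  by (simp add: D21_bracket_def vec.scale_sum_right mult_ac)

lemma D21_linear_left: "Vector_Spaces.linear (*s) (*s) (\<lambda>a. D21_bracket \<alpha> a b)"
  by unfold_locales (simp_all add: D21_bracket_add_left D21_bracket_scale_left)

lemma D21_linear_right: "Vector_Spaces.linear (*s) (*s) (D21_bracket \<alpha> a)"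
  by unfold_locales (simp_all add: D21_bracket_add_right D21_bracket_scale_right)

lemma D21_bracket_zero: "D21_bracket \<alpha> 0 w = 0" "D21_bracket \<alpha> w 0 = 0"
  by (simp_all add: D21_bracket_def)

lemma D21_bracket_minus: "D21_bracket \<alpha> (- u) w = - D21_bracket \<alpha> u w" "D21_bracket \<alpha> w (- u) = - D21_bracket \<alpha> w u"
  using D21_bracket_scale_left[of \<alpha> "-1" u w] D21_bracket_scale_right[of \<alpha> w "-1" u] by simp_all

lemma D21_bracket_basis_vec: "D21_bracket \<alpha> (basis_vec a) (basis_vec b) = D21_bracket_basis \<alpha> a b"
proof -
  have "D21_bracket \<alpha> (basis_vec a) (basis_vec b)
      = (\<Sum>i\<in>UNIV. if i = a then (\<Sum>j\<in>UNIV. if j = b then D21_bracket_basis \<alpha> i j else 0) else 0)"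
    unfolding D21_bracket_def
    by (intro sum.cong refl) (auto simp: axis_def if_distrib[of "\<lambda>c. c *s _"] cong: if_cong)
  then show ?thesis by (simp add: sum.delta)
qed

lemma D21_bracket_diff:
  "D21_bracket \<alpha> (u - v) w = D21_bracket \<alpha> u w - D21_bracket \<alpha> v w"
  "D21_bracket \<alpha> w (u - v) = D21_bracket \<alpha> w u - D21_bracket \<alpha> w v"
  using D21_bracket_add_left[of \<alpha> u "- v" w] D21_bracket_add_right[of \<alpha> w u "- v"] by (simp_all add: D21_bracket_minus)

lemmas D21_lin = D21_bracket_diff D21_bracket_add_left D21_bracket_add_right D21_bracket_scale_left
  D21_bracket_scale_right D21_bracket_zero D21_bracket_minus D21_bracket_basis_vec


lemma D21_basis_cases:
  obtains "a = H D1" | "a = H D2" | "a = H D3" | "a = Xe D1 Plus" | "a = Xe D1 Minus"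
    | "a = Xe D2 Plus" | "a = Xe D2 Minus" | "a = Xe D3 Plus" | "a = Xe D3 Minus"
    | "a = Xo Plus Plus Plus" | "a = Xo Plus Plus Minus" | "a = Xo Plus Minus Plus"
    | "a = Xo Plus Minus Minus" | "a = Xo Minus Plus Plus" | "a = Xo Minus Plus Minus"
    | "a = Xo Minus Minus Plus" | "a = Xo Minus Minus Minus"
proof -
  have "a \<in> UNIV" by simp
  then show thesis unfolding UNIV_D21_basis by (elim insertE emptyE) (fact that)+
qed

lemma D21_bracket_basis_skew:
  "D21_bracket_basis \<alpha> a b = (- ksign (odd_basis a \<and> odd_basis b)) *s D21_bracket_basis \<alpha> b a"
  by (cases a rule: D21_basis_cases; cases b rule: D21_basis_cases;
      simp add: ksign_def; simp add: vec_eq_iff field_simps)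

lemma D21_bracket_basis_parity:
  "D21_bracket_basis \<alpha> a b $ c \<noteq> 0 \<Longrightarrow> odd_basis c = (odd_basis a \<noteq> odd_basis b)"
  by (cases a rule: D21_basis_cases; cases b rule: D21_basis_cases;
      auto simp: axis_def split: if_splits)

lemma D21_jacobi_basis:
  "D21_bracket \<alpha> (basis_vec a) (D21_bracket_basis \<alpha> b c) =
     D21_bracket \<alpha> (D21_bracket_basis \<alpha> a b) (basis_vec c)
     + ksign (odd_basis a \<and> odd_basis b) *s
         D21_bracket \<alpha> (basis_vec b) (D21_bracket_basis \<alpha> a c)" (is "?J a b c")
proof -
  have "?J (H i) b c" for i
    by (cases i; cases b rule: D21_basis_cases; cases c rule: D21_basis_cases;
        simp add: D21_lin ksign_def; simp add: vec_eq_iff field_simps power2_eq_square)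
  moreover have "?J (Xe i s) b c" for i s
    by (cases i; cases s; cases b rule: D21_basis_cases; cases c rule: D21_basis_cases;
        simp add: D21_lin ksign_def; simp add: vec_eq_iff field_simps power2_eq_square)
  moreover have "?J (Xo Plus s t) b c" for s t
    by (cases s; cases t; cases b rule: D21_basis_cases; cases c rule: D21_basis_cases;
        simp add: D21_lin ksign_def; simp add: vec_eq_iff field_simps power2_eq_square)
  moreover have "?J (Xo Minus s t) b c" for s t
    by (cases s; cases t; cases b rule: D21_basis_cases; cases c rule: D21_basis_cases;
        simp add: D21_lin ksign_def; simp add: vec_eq_iff field_simps power2_eq_square)
  ultimately show ?thesis
    by (cases a rule: D21_basis_cases) simp_all
qed

lemma D21_expand: "(u :: D21) = (\<Sum>b\<in>UNIV. u $ b *s basis_vec b)"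
  by (rule basis_expansion[symmetric])

lemma D21_induct [consumes 1, case_names zero basis scale add]:
  assumes "u \<in> D21_part p" "P 0" "\<And>b. odd_basis b = p \<Longrightarrow> P (basis_vec b)"
    "\<And>k u. P u \<Longrightarrow> P (k *s u)" "\<And>u v. P u \<Longrightarrow> P v \<Longrightarrow> P (u + v)"
  shows "P u"
proof -
  have "P (\<Sum>b\<in>B. u $ b *s basis_vec b)" for B
  proof (induction B rule: infinite_finite_induct)
    case (insert b B)
    have "P (u $ b *s basis_vec b)"
      using assms by (cases "u $ b = 0") (auto simp: D21_part_def)
    with insert show ?case using assms by simp
  qed (use assms in simp_all)
  from this[of UNIV] show ?thesis using D21_expand[of u] by simp
qed

lemma D21_skew:
  assumes "a \<in> D21_part p" "b \<in> D21_part q"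
  shows "D21_bracket \<alpha> a b = (- ksign (p \<and> q)) *s D21_bracket \<alpha> b a"
  using assms(1)
proof (induction a rule: D21_induct)
  case (basis i)
  from assms(2) show ?case
  proof (induction b rule: D21_induct)
    case (basis j)
    then show ?case using \<open>odd_basis i = p\<close> D21_bracket_basis_skew[of \<alpha> i j] by (simp add: D21_lin)
  qed (simp_all add: D21_lin vec.scale_right_distrib vec.scale_right_diff_distrib mult.commute)
qed (simp_all add: D21_lin vec.scale_right_distrib vec.scale_right_diff_distrib mult.commute)

lemma D21_part_subspace: "vec.subspace (D21_part p)"
proof (rule vec.subspaceI)
  fix x y assume "x \<in> D21_part p" "y \<in> D21_part p"
  then show "x + y \<in> D21_part p"
    unfolding D21_part_def by (smt (verit) add_cancel_left_left mem_Collect_eq vector_add_component)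
qed (auto simp: D21_part_def)

lemma D21_grading:
  assumes "a \<in> D21_part p" "b \<in> D21_part q"
  shows "D21_bracket \<alpha> a b \<in> D21_part (p \<noteq> q)"
  using assms(1)
proof (induction a rule: D21_induct)
  case (basis i)
  from assms(2) show ?case
  proof (induction b rule: D21_induct)
    case (basis j)
    then show ?case using \<open>odd_basis i = p\<close> D21_bracket_basis_parity[of \<alpha> i j]
      by (auto simp add: D21_lin D21_part_def)
  qed (simp_all add: D21_lin vec.subspace_0 vec.subspace_add vec.subspace_scale D21_part_subspace)
qed (simp_all add: D21_lin vec.subspace_0 vec.subspace_add vec.subspace_scale D21_part_subspace)

lemma D21_part_decompose: "\<exists>v0\<in>D21_part False. \<exists>v1\<in>D21_part True. v = v0 + v1"
  by (rule bexI[of _ "\<chi> b. if odd_basis b then 0 else v $ b"],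
      rule bexI[of _ "\<chi> b. if odd_basis b then v $ b else 0"])
    (auto simp: D21_part_def vec_eq_iff)

lemma D21_jacobi:
  assumes "a \<in> D21_part p" "b \<in> D21_part q"
  shows "D21_bracket \<alpha> a (D21_bracket \<alpha> b c) =
     D21_bracket \<alpha> (D21_bracket \<alpha> a b) c + ksign (p \<and> q) *s D21_bracket \<alpha> b (D21_bracket \<alpha> a c)"
proof -
  have hom: "D21_bracket \<alpha> a (D21_bracket \<alpha> b c) =
      D21_bracket \<alpha> (D21_bracket \<alpha> a b) c + ksign (p \<and> q) *s D21_bracket \<alpha> b (D21_bracket \<alpha> a c)"
    if "c \<in> D21_part r" for c r
    using assms(1)
  proof (induction a rule: D21_induct)
    case (basis i)
    from assms(2) show ?case
    proof (induction b rule: D21_induct)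
      case (basis j)
      from that show ?case
      proof (induction c rule: D21_induct)
        case (basis k)
        show ?case using D21_jacobi_basis[of \<alpha> i j k] \<open>odd_basis i = p\<close> \<open>odd_basis j = q\<close>
          by (simp add: D21_lin)
      qed (simp_all add: D21_lin vec.scale_right_distrib mult.commute)
    qed (simp_all add: D21_lin vec.scale_right_distrib mult.commute)
  qed (simp_all add: D21_lin vec.scale_right_distrib mult.commute)
  obtain c0 c1 where "c0 \<in> D21_part False" "c1 \<in> D21_part True" and c: "c = c0 + c1"
    using D21_part_decompose by metis
  then show ?thesis
    using hom[of c0 False] hom[of c1 True] by (simp add: D21_lin vec.scale_right_distrib)
qed

theorem D21_lie_superalgebra: "lie_superalgebra (*s) D21_part (D21_bracket \<alpha>)"
proof -
  have "D21_part False \<inter> D21_part True = {0}"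
    by (auto simp: D21_part_def vec_eq_iff)
  then have "super_vector_space (*s) D21_part"
    using D21_part_decompose
    by (simp add: super_vector_space_def D21_part_subspace vec.vector_space_axioms)
  then show ?thesis
    unfolding lie_superalgebra_def
    using D21_linear_left D21_linear_right D21_grading D21_skew D21_jacobi by blast
qed

lemma D21_normalisation:
  "D21_bracket \<alpha> (basis_vec (Xe D2 Plus)) (basis_vec (Xe D2 Minus)) = basis_vec (H D2)"
  "D21_bracket \<alpha> (basis_vec (Xe D3 Plus)) (basis_vec (Xe D3 Minus)) = basis_vec (H D3)"
  "D21_bracket \<alpha> (basis_vec (Xo Plus Minus Minus)) (basis_vec (Xo Minus Plus Plus)) =
     (- ((1 + \<alpha>) / 2)) *s basis_vec (H D1) - (1 / 2) *s basis_vec (H D2)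
     - (\<alpha> / 2) *s basis_vec (H D3)"
  by (simp_all add: D21_lin)

text \<open>\<open>e\<close> lists the simple root vectors, of roots $2\delta_2$,
  $\delta_1-\delta_2-\delta_3$, $2\delta_3$, and the simple coroots are the brackets $[e_i,f_i]$.\<close>

lemma D21_cartan_matrix:
  fixes \<alpha> :: complex
  defines "e \<equiv> [basis_vec (Xe D2 Plus), basis_vec (Xo Plus Minus Minus), basis_vec (Xe D3 Plus)]"
    and "f \<equiv> [basis_vec (Xe D2 Minus), basis_vec (Xo Minus Plus Plus), basis_vec (Xe D3 Minus)]"
    and "A \<equiv> [[2, - 1, 0], [- 1, 0, - \<alpha>], [0, - 1, 2]]"
  shows "\<forall>i < 3. \<forall>j < 3. D21_bracket \<alpha> (D21_bracket \<alpha> (e ! i) (f ! i)) (e ! j) = (A ! i ! j) *s (e ! j)"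
    and "\<forall>i < 3. \<forall>j < 3. i \<noteq> j \<longrightarrow> D21_bracket \<alpha> (e ! i) (f ! j) = 0"
  unfolding e_def f_def A_def
  by (simp add: numeral_3_eq_3 All_less_Suc D21_lin; simp add: vec_eq_iff field_simps)
    (simp add: numeral_3_eq_3 All_less_Suc D21_lin)

lemma D21_H_component: "D21_bracket \<alpha> (basis_vec (H i)) u $ b = weight b i * u $ b"
proof -
  have "D21_bracket \<alpha> (basis_vec (H i)) u = (\<Sum>b\<in>UNIV. u $ b *s D21_bracket_basis \<alpha> (H i) b)"
  proof -
    interpret l: Vector_Spaces.linear "(*s)" "(*s)" "D21_bracket \<alpha> (basis_vec (H i))" by (rule D21_linear_right)
    show ?thesis by (subst D21_expand[of u]) (simp add: l.sum l.scale D21_lin)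
  qed
  then show ?thesis by (simp add: axis_def if_distrib cong: if_cong)
qed

theorem D21_simple:
  assumes "\<alpha> \<noteq> 0" "\<alpha> \<noteq> - 1"
    and "vec.subspace I" and "\<And>a w. w \<in> I \<Longrightarrow> D21_bracket \<alpha> a w \<in> I" and "I \<noteq> {0}"
  shows "I = UNIV"
proof -
  note sub = vec.subspace_add[OF assms(3)] vec.subspace_diff[OF assms(3)] vec.subspace_scale[OF assms(3)]
  have scaleD: "v \<in> I" if "k *s v \<in> I" "k \<noteq> 0" for k v
    using sub(3)[OF that(1), of "inverse k"] that(2) by simp
  have ad: "D21_bracket_basis \<alpha> a b \<in> I" if "basis_vec b \<in> I" for a b
    using assms(4)[OF that, of "basis_vec a"] by (simp add: D21_bracket_basis_vec)
  define supp where "supp u = {b. u $ b \<noteq> 0}" for u :: D21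
  obtain u0 where "u0 \<in> I" "u0 \<noteq> 0" using assms(3,5) vec.subspace_0 by blast
  then obtain u where u: "u \<in> I" "u \<noteq> 0" and
    min: "\<And>w. w \<in> I \<Longrightarrow> w \<noteq> 0 \<Longrightarrow> card (supp u) \<le> card (supp w)"
    using ex_has_least_nat[of "\<lambda>u. u \<in> I \<and> u \<noteq> 0" u0 "\<lambda>u. card (supp u)"] by blast
  have same: "weight b = weight c" if "u $ b \<noteq> 0" "u $ c \<noteq> 0" for b c
  proof (rule ccontr)
    assume "weight b \<noteq> weight c"
    then obtain i where i: "weight b i \<noteq> weight c i" by blast
    define w where "w = D21_bracket \<alpha> (basis_vec (H i)) u - weight b i *s u"
    have w: "w $ d = (weight d i - weight b i) * u $ d" for d
      by (simp add: w_def D21_H_component algebra_simps)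
    have "w \<in> I" using u assms(4) sub by (simp add: w_def)
    moreover have "w $ c \<noteq> 0" using w[of c] i that by simp
    then have "w \<noteq> 0" by auto
    moreover have "supp w \<subset> supp u" using w that by (auto simp: supp_def)
    then have "card (supp w) < card (supp u)" by (intro psubset_card_mono) auto
    ultimately show False using min by force
  qed
  have root: "\<exists>b. basis_vec b \<in> I \<and> (\<forall>i. b \<noteq> H i)"
  proof (cases "\<exists>i. u $ H i \<noteq> 0")
    case True
    then obtain i where i: "u $ H i \<noteq> 0" by blast
    have z: "u $ b = 0" if "\<forall>j. b \<noteq> H j" for b
    proof (rule ccontr)
      assume "u $ b \<noteq> 0"
      then have "weight b = weight (H i)" using same i by blast
      moreover have "weight b = (\<lambda>_. 0)" using calculation by auto
      ultimately show False using that
        by (cases b rule: D21_basis_cases) (auto dest: fun_cong[of _ _ D1] fun_cong[of _ _ D2] fun_cong[of _ _ D3])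
    qed
    have "D21_bracket \<alpha> (basis_vec (Xe i Plus)) u = (\<Sum>b\<in>UNIV. u $ b *s D21_bracket_basis \<alpha> (Xe i Plus) b)"
    proof -
      interpret l: Vector_Spaces.linear "(*s)" "(*s)" "D21_bracket \<alpha> (basis_vec (Xe i Plus))" by (rule D21_linear_right)
      show ?thesis by (subst D21_expand[of u]) (simp add: l.sum l.scale D21_lin)
    qed
    also have "\<dots> = (- 2 * u $ H i) *s basis_vec (Xe i Plus)"
      using z by (cases i) (simp_all add: UNIV_D21_basis)
    finally have "(- 2 * u $ H i) *s basis_vec (Xe i Plus) \<in> I"
      using u assms(4)[of u "basis_vec (Xe i Plus)"] by metis
    then have "basis_vec (Xe i Plus) \<in> I"
      using i scaleD[of "- 2 * u $ H i"] by auto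
    then show ?thesis by blast
  next
    case False
    obtain b where b: "u $ b \<noteq> 0" using u(2) by (auto simp: vec_eq_iff)
    have "u $ c = 0" if "c \<noteq> b" for c
    proof (rule ccontr)
      assume "u $ c \<noteq> 0"
      then have "weight c = weight b" "\<forall>i. c \<noteq> H i" "\<forall>i. b \<noteq> H i" using same b False by blast+
      then show False using that
        by (cases b rule: D21_basis_cases; cases c rule: D21_basis_cases)
          (auto dest: fun_cong[of _ _ D1] fun_cong[of _ _ D2] fun_cong[of _ _ D3])
    qed
    then have "u = u $ b *s basis_vec b" by (auto simp: vec_eq_iff axis_def)
    then have "basis_vec b \<in> I" using u b scaleD by metis
    then show ?thesis using b False by blast
  qed
  have a1: "1 + \<alpha> \<noteq> 0" using assms(2) by (metis add.commute add_eq_0_iff)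
  have sg0: "sg s \<noteq> 0" for s by (cases s) auto
  have ad': "v \<in> I" if "basis_vec b \<in> I" "D21_bracket_basis \<alpha> a b = k *s v" "k \<noteq> 0" for a b k v
    using ad[OF that(1), of a] that(2,3) scaleD by metis
  have "\<exists>s1 s2 s3. basis_vec (Xo s1 s2 s3) \<in> I"
  proof -
    obtain b where b: "basis_vec b \<in> I" "\<forall>i. b \<noteq> H i" using root by blast
    show ?thesis
    proof (cases b)
      case (Xe i s)
      define s' where "s' = (if s = Plus then Minus else Plus)"
      have [simp]: "s' \<noteq> s" by (simp add: s'_def)
      show ?thesis
      proof (cases i)
        case D1
        have "(- 1 - \<alpha>) *s v = - ((1 + \<alpha>) *s v)" for v :: D21
          by (simp add: vec_eq_iff algebra_simps)
        then have "basis_vec (Xo s Plus Plus) \<in> I"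
          using ad'[OF b(1), of "Xo s' Plus Plus" "- 1 - \<alpha>" "basis_vec (Xo s Plus Plus)"] Xe a1 D1 assms(2)
          by simp
        then show ?thesis by blast
      next
        case D2
        then show ?thesis
          using ad'[OF b(1), of "Xo Plus s' Plus" 1 "basis_vec (Xo Plus s Plus)"] Xe by auto
      next
        case D3
        then show ?thesis
          using ad'[OF b(1), of "Xo Plus Plus s'" 1 "basis_vec (Xo Plus Plus s)"] Xe by auto
      qed
    qed (use b in auto)
  qed
  then obtain s1 s2 s3 where o0: "basis_vec (Xo s1 s2 s3) \<in> I" by blast
  have flip1: "basis_vec (Xo t s2 s3) \<in> I" if "basis_vec (Xo s1 s2 s3) \<in> I" for t s1 s2 s3
    using ad'[OF that, of "Xe D1 t" "(1 + \<alpha>) * sg s2 * sg s3" "basis_vec (Xo t s2 s3)"] that a1 sg0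
    by (cases "s1 = t") simp_all
  have flip2: "basis_vec (Xo s1 t s3) \<in> I" if "basis_vec (Xo s1 s2 s3) \<in> I" for t s1 s2 s3
    using ad'[OF that, of "Xe D2 t" "- sg s1" "basis_vec (Xo s1 t s3)"] that sg0
    by (cases "s2 = t") simp_all
  have flip3: "basis_vec (Xo s1 s2 t) \<in> I" if "basis_vec (Xo s1 s2 s3) \<in> I" for t s1 s2 s3
    using ad'[OF that, of "Xe D3 t" "- sg s1" "basis_vec (Xo s1 s2 t)"] that sg0
    by (cases "s3 = t") simp_all
  have odd: "basis_vec (Xo t1 t2 t3) \<in> I" for t1 t2 t3
    using flip1[OF flip2[OF flip3[OF o0]]] .
  have even: "basis_vec (Xe i s) \<in> I" for i s
  proof (cases i)
    case D1
    then show ?thesis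
      using ad'[OF odd, of "Xo s Plus Plus" s Minus Minus "sg s" "basis_vec (Xe D1 s)"] sg0 by simp
  next
    case D2
    then show ?thesis
      using ad'[OF odd, of "Xo Plus s Plus" Minus s Minus "- 1" "basis_vec (Xe D2 s)"] by simp
  next
    case D3
    then show ?thesis
      using ad'[OF odd, of "Xo Plus Plus s" Minus Minus s "- \<alpha>" "basis_vec (Xe D3 s)"] assms(1) by simp
  qed
  have cartan: "basis_vec (H i) \<in> I" for i
    using ad'[OF even, of "Xe i Plus" i Minus "if i = D1 then (1 + \<alpha>)\<^sup>2 else 1" "basis_vec (H i)"] a1
    by auto
  have "basis_vec b \<in> I" for b
    using odd even cartan by (cases b) auto
  then have "u \<in> I" for u
    by (subst D21_expand) (intro vec.subspace_sum[OF assms(3)] sub)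
  then show ?thesis by blast
qed


section \<open>The superpolynomial space and the representation\<close>

text \<open>\<open>(a, b, c, d)\<close> stands for the monomial $x^a y^b \theta^c \eta^d$, in this order of the odd
  variables; for the Boolean exponents \<^term>\<open>True\<close> is \<open>1\<close>. Superpolynomials are the
  finitely supported coefficient functions on these monomials.\<close>

type_synonym monomial = "nat \<times> nat \<times> bool \<times> bool"
type_synonym superpoly = "monomial \<Rightarrow>\<^sub>0 complex"

definition pscale :: "complex \<Rightarrow> superpoly \<Rightarrow> superpoly"  (infixr \<open>*\<^sub>p\<close> 75) where
  "c *\<^sub>p f = Poly_Mapping.map (\<lambda>z. c * z) f"

definition superpoly_part :: "bool \<Rightarrow> superpoly set" where
  "superpoly_part p = {f. \<forall>(a, b, c, d) \<in> Poly_Mapping.keys f. (c \<noteq> d) = p}"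

definition lin_ext :: "(monomial \<Rightarrow> superpoly) \<Rightarrow> superpoly \<Rightarrow> superpoly" where
  "lin_ext T f = (\<Sum>m\<in>Poly_Mapping.keys f. Poly_Mapping.lookup f m *\<^sub>p T m)"

definition mul_x :: "superpoly \<Rightarrow> superpoly" where
  "mul_x = lin_ext (\<lambda>(a, b, c, d). Poly_Mapping.single (a + 1, b, c, d) 1)"

definition mul_y :: "superpoly \<Rightarrow> superpoly" where
  "mul_y = lin_ext (\<lambda>(a, b, c, d). Poly_Mapping.single (a, b + 1, c, d) 1)"

definition mul_theta :: "superpoly \<Rightarrow> superpoly" where
  "mul_theta = lin_ext (\<lambda>(a, b, c, d). if c then 0 else Poly_Mapping.single (a, b, True, d) 1)"

definition mul_eta :: "superpoly \<Rightarrow> superpoly" where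
  "mul_eta = lin_ext (\<lambda>(a, b, c, d).
     if d then 0 else Poly_Mapping.single (a, b, c, True) (ksign c))"

definition d_x :: "superpoly \<Rightarrow> superpoly" where
  "d_x = lin_ext (\<lambda>(a, b, c, d). Poly_Mapping.single (a - 1, b, c, d) (of_nat a))"

definition d_y :: "superpoly \<Rightarrow> superpoly" where
  "d_y = lin_ext (\<lambda>(a, b, c, d). Poly_Mapping.single (a, b - 1, c, d) (of_nat b))"

definition d_theta :: "superpoly \<Rightarrow> superpoly" where
  "d_theta = lin_ext (\<lambda>(a, b, c, d). if c then Poly_Mapping.single (a, b, False, d) 1 else 0)"

definition d_eta :: "superpoly \<Rightarrow> superpoly" where
  "d_eta = lin_ext (\<lambda>(a, b, c, d).
     if d then Poly_Mapping.single (a, b, c, False) (ksign c) else 0)"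

fun pi_basis :: "complex \<Rightarrow> complex \<Rightarrow> D21_basis \<Rightarrow> superpoly \<Rightarrow> superpoly" where
  "pi_basis \<alpha> lam (Xe D3 Minus) f = mul_x f"
| "pi_basis \<alpha> lam (Xe D2 Minus) f = mul_y f"
| "pi_basis \<alpha> lam (Xo Plus Minus Minus) f = mul_theta f"
| "pi_basis \<alpha> lam (Xo Minus Minus Minus) f = mul_eta f"
| "pi_basis \<alpha> lam (H D1) f = mul_theta (d_theta f) - mul_eta (d_eta f)"
| "pi_basis \<alpha> lam (H D2) f =
     lam *\<^sub>p f - 2 *\<^sub>p mul_y (d_y f) - mul_theta (d_theta f) - mul_eta (d_eta f)"
| "pi_basis \<alpha> lam (H D3) f =
     (lam / \<alpha>) *\<^sub>p f - 2 *\<^sub>p mul_x (d_x f) - mul_theta (d_theta f) - mul_eta (d_eta f)"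
| "pi_basis \<alpha> lam (Xe D1 Plus) f = (1 + \<alpha>) *\<^sub>p mul_theta (d_eta f)"
| "pi_basis \<alpha> lam (Xe D1 Minus) f = (1 + \<alpha>) *\<^sub>p mul_eta (d_theta f)"
| "pi_basis \<alpha> lam (Xo Minus Plus Minus) f = - mul_eta (d_y f) - \<alpha> *\<^sub>p mul_x (d_theta f)"
| "pi_basis \<alpha> lam (Xo Plus Minus Plus) f = mul_theta (d_x f) - mul_y (d_eta f)"
| "pi_basis \<alpha> lam (Xo Plus Plus Minus) f = mul_theta (d_y f) - \<alpha> *\<^sub>p mul_x (d_eta f)"
| "pi_basis \<alpha> lam (Xo Minus Minus Plus) f = - mul_eta (d_x f) - mul_y (d_theta f)"
| "pi_basis \<alpha> lam (Xe D3 Plus) f =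
     (let g = d_x f in
        (lam / \<alpha>) *\<^sub>p g - mul_x (d_x g) - mul_theta (d_theta g) - mul_eta (d_eta g))
     + mul_y (d_eta (d_theta f))"
| "pi_basis \<alpha> lam (Xe D2 Plus) f =
     (let g = d_y f in
        lam *\<^sub>p g - mul_y (d_y g) - mul_theta (d_theta g) - mul_eta (d_eta g))
     + \<alpha> *\<^sub>p mul_x (d_eta (d_theta f))"
| "pi_basis \<alpha> lam (Xo Minus Plus Plus) f =
     (let g = d_theta f in
        (- lam) *\<^sub>p g + \<alpha> *\<^sub>p mul_x (d_x g) + mul_y (d_y g) + (1 + \<alpha>) *\<^sub>p mul_eta (d_eta g))
     + mul_eta (d_x (d_y f))"
| "pi_basis \<alpha> lam (Xo Plus Plus Plus) f =
     (let g = d_eta f in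
        lam *\<^sub>p g - \<alpha> *\<^sub>p mul_x (d_x g) - mul_y (d_y g) - (1 + \<alpha>) *\<^sub>p mul_theta (d_theta g))
     + mul_theta (d_x (d_y f))"

definition pi_rep :: "complex \<Rightarrow> complex \<Rightarrow> D21 \<Rightarrow> superpoly \<Rightarrow> superpoly" where
  "pi_rep \<alpha> lam u f = (\<Sum>b\<in>UNIV. u $ b *\<^sub>p pi_basis \<alpha> lam b f)"

end

(*
The constant 1 (the "vacuum") generates the whole module, since g_- acts by multiplications, and its
weight has multiplicity one. So a submodule containing an element with nonzero constant term is
everything; of two submodules summing to the module one has such an element, whence
indecomposability for every lam.

If lam and lam/alpha are not natural numbers, every nonzero f can be moved to a nonzero constant
term. Terms with exactly one odd variable are lowered to theta or eta by X_{2 delta_2} and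
X_{2 delta_3}, with factors lam - b and lam/alpha - a, and then to a constant with factor +-lam. If f has
no term that is sent to one with exactly one odd variable, then comparing the coefficients of
x^{a+1} y^{b+1} and x^a y^b theta eta yields a factor b + 1 - lam, so f is constant.

If lam/alpha = n (resp. lam = n), an explicit proper submodule is cut out by linear conditions on
coefficients: it contains only powers x^a with a >= n (resp. y^b with b >= n), the boundary terms
x^n y^b - n x^{n-1} y^{b-1} theta eta being the ones killed by X_{2 delta_3}.
*)
theory Submission
  imports Defs
begin

section \<open>Coefficients and the Weyl-Clifford relations\<close>

abbreviation coef :: "superpoly \<Rightarrow> monomial \<Rightarrow> complex" where
  "coef \<equiv> Poly_Mapping.lookup"

lemma coef_pscale [simp]: "coef (c *\<^sub>p f) m = c * coef f m"
  by (simp add: pscale_def Poly_Mapping.map.rep_eq when_def)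

interpretation superpoly: vector_space pscale
  by unfold_locales (rule poly_mapping_eqI; simp add: lookup_add algebra_simps)+

lemma coef_lin_ext: "coef (lin_ext T f) m = (\<Sum>k\<in>Poly_Mapping.keys f. coef f k * coef (T k) m)"
  by (simp add: lin_ext_def lookup_sum)

text \<open>Each elementary operator sends different monomials to multiples of different monomials,
  or to 0, so an output coefficient has at most one source monomial \<open>k0\<close>. This turns
  the sums defining \<open>lin_ext\<close> into closed formulas.\<close>

lemma coef_lin_ext_unique:
  assumes "\<And>k. k \<noteq> k0 \<Longrightarrow> coef (T k) m = 0"
  shows "coef (lin_ext T f) m = coef f k0 * coef (T k0) m"
proof -
  have "coef (lin_ext T f) m = (\<Sum>k\<in>Poly_Mapping.keys f. if k = k0 then coef f k0 * coef (T k0) m else 0)"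
    unfolding coef_lin_ext using assms by (intro sum.cong) auto
  then show ?thesis by (auto simp: sum.delta in_keys_iff)
qed

lemma coef_lin_ext_zero:
  assumes "\<And>k. coef (T k) m = 0"
  shows "coef (lin_ext T f) m = 0"
  using assms by (simp add: coef_lin_ext)

section \<open>Coefficient formulas for the multiplications and derivatives\<close>

lemma coef_mul_x: "coef (mul_x f) (a, b, c, d) = (if a = 0 then 0 else coef f (a - 1, b, c, d))"
  unfolding mul_x_def
  by (cases a) (auto simp: lookup_single when_def intro!: coef_lin_ext_zero
      coef_lin_ext_unique[of "(a - 1, b, c, d)", THEN trans] split: prod.splits if_splits)

lemma coef_mul_y: "coef (mul_y f) (a, b, c, d) = (if b = 0 then 0 else coef f (a, b - 1, c, d))"
  unfolding mul_y_def
  by (cases b) (auto simp: lookup_single when_def intro!: coef_lin_ext_zero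
      coef_lin_ext_unique[of "(a, b - 1, c, d)", THEN trans] split: prod.splits if_splits)

lemma coef_mul_theta: "coef (mul_theta f) (a, b, c, d) = (if c then coef f (a, b, False, d) else 0)"
  unfolding mul_theta_def
  by (cases c) (auto simp: lookup_single when_def intro!: coef_lin_ext_zero
      coef_lin_ext_unique[of "(a, b, False, d)", THEN trans] split: prod.splits if_splits)

text \<open>Monomials are written with theta before eta, so eta has to pass theta; this is the sign
  \<open>ksign c\<close>, and it recurs in \<open>coef_d_eta\<close>.\<close>

lemma coef_mul_eta: "coef (mul_eta f) (a, b, c, d) = (if d then ksign c * coef f (a, b, c, False) else 0)"
  unfolding mul_eta_def
  by (cases d) (auto simp: lookup_single when_def intro!: coef_lin_ext_zero
      coef_lin_ext_unique[of "(a, b, c, False)", THEN trans] split: prod.splits if_splits)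

text \<open>Truncated subtraction sends the exponents 0 and 1 both to 0, but exponent 0 carries the
  factor \<open>of_nat 0\<close>, so \<open>a + 1\<close> is the only source.\<close>

lemma coef_d_x: "coef (d_x f) (a, b, c, d) = of_nat (a + 1) * coef f (a + 1, b, c, d)"
  unfolding d_x_def
  by (auto simp: lookup_single when_def
      intro!: coef_lin_ext_unique[of "(a + 1, b, c, d)", THEN trans] split: prod.splits if_splits)

lemma coef_d_y: "coef (d_y f) (a, b, c, d) = of_nat (b + 1) * coef f (a, b + 1, c, d)"
  unfolding d_y_def
  by (auto simp: lookup_single when_def
      intro!: coef_lin_ext_unique[of "(a, b + 1, c, d)", THEN trans] split: prod.splits if_splits)

lemma coef_d_theta: "coef (d_theta f) (a, b, c, d) = (if c then 0 else coef f (a, b, True, d))"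
  unfolding d_theta_def
  by (cases c) (auto simp: lookup_single when_def intro!: coef_lin_ext_zero
      coef_lin_ext_unique[of "(a, b, True, d)", THEN trans] split: prod.splits if_splits)

lemma coef_d_eta: "coef (d_eta f) (a, b, c, d) = (if d then 0 else ksign c * coef f (a, b, c, True))"
  unfolding d_eta_def
  by (cases d) (auto simp: lookup_single when_def intro!: coef_lin_ext_zero
      coef_lin_ext_unique[of "(a, b, c, True)", THEN trans] split: prod.splits if_splits)

lemmas coefs = coef_mul_x coef_mul_y coef_mul_theta coef_mul_eta coef_d_x coef_d_y coef_d_theta
  coef_d_eta lookup_add lookup_minus lookup_uminus

lemma superpoly_eqI: "(\<And>a b c d. coef f (a, b, c, d) = coef g (a, b, c, d)) \<Longrightarrow> f = g"
  by (rule poly_mapping_eqI) auto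

section \<open>Linearity and commutation rules of the elementary operators\<close>

lemma mul_add: "mul_x (f + g) = mul_x f + mul_x g" "mul_y (f + g) = mul_y f + mul_y g"
  "mul_theta (f + g) = mul_theta f + mul_theta g" "mul_eta (f + g) = mul_eta f + mul_eta g"
  by (rule superpoly_eqI; simp add: coefs algebra_simps)+

lemma d_add: "d_x (f + g) = d_x f + d_x g" "d_y (f + g) = d_y f + d_y g"
  "d_theta (f + g) = d_theta f + d_theta g" "d_eta (f + g) = d_eta f + d_eta g"
  by (rule superpoly_eqI; simp add: coefs algebra_simps)+

lemma mul_pscale: "mul_x (k *\<^sub>p f) = k *\<^sub>p mul_x f" "mul_y (k *\<^sub>p f) = k *\<^sub>p mul_y f"
  "mul_theta (k *\<^sub>p f) = k *\<^sub>p mul_theta f" "mul_eta (k *\<^sub>p f) = k *\<^sub>p mul_eta f"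
  by (rule superpoly_eqI; simp add: coefs)+

lemma d_pscale: "d_x (k *\<^sub>p f) = k *\<^sub>p d_x f" "d_y (k *\<^sub>p f) = k *\<^sub>p d_y f"
  "d_theta (k *\<^sub>p f) = k *\<^sub>p d_theta f" "d_eta (k *\<^sub>p f) = k *\<^sub>p d_eta f"
  by (rule superpoly_eqI; simp add: coefs)+

lemma mul_minus: "mul_x (- f) = - mul_x f" "mul_y (- f) = - mul_y f"
  "mul_theta (- f) = - mul_theta f" "mul_eta (- f) = - mul_eta f"
  by (rule superpoly_eqI; simp add: coefs)+

lemma d_minus: "d_x (- f) = - d_x f" "d_y (- f) = - d_y f"
  "d_theta (- f) = - d_theta f" "d_eta (- f) = - d_eta f"
  by (rule superpoly_eqI; simp add: coefs)+

lemma mul_diff: "mul_x (f - g) = mul_x f - mul_x g" "mul_y (f - g) = mul_y f - mul_y g"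
  "mul_theta (f - g) = mul_theta f - mul_theta g" "mul_eta (f - g) = mul_eta f - mul_eta g"
  by (rule superpoly_eqI; simp add: coefs algebra_simps)+

lemma d_diff: "d_x (f - g) = d_x f - d_x g" "d_y (f - g) = d_y f - d_y g"
  "d_theta (f - g) = d_theta f - d_theta g" "d_eta (f - g) = d_eta f - d_eta g"
  by (rule superpoly_eqI; simp add: coefs algebra_simps)+

lemma op_zero: "mul_x 0 = 0" "mul_y 0 = 0" "mul_theta 0 = 0" "mul_eta 0 = 0"
  "d_x 0 = 0" "d_y 0 = 0" "d_theta 0 = 0" "d_eta 0 = 0"
  by (rule superpoly_eqI; simp add: coefs)+

lemmas op_linear = mul_add d_add mul_pscale d_pscale mul_minus d_minus mul_diff d_diff op_zero

lemma weyl_clifford: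
  "d_x (mul_x f) = f + mul_x (d_x f)" "d_y (mul_y f) = f + mul_y (d_y f)"
  "d_theta (mul_theta f) = f - mul_theta (d_theta f)" "d_eta (mul_eta f) = f - mul_eta (d_eta f)"
  by (rule superpoly_eqI; simp add: coefs ksign_def algebra_simps of_nat_diff)+

lemma mul_mul_comm:
  "mul_y (mul_x f) = mul_x (mul_y f)" "mul_theta (mul_x f) = mul_x (mul_theta f)"
  "mul_eta (mul_x f) = mul_x (mul_eta f)" "mul_theta (mul_y f) = mul_y (mul_theta f)"
  "mul_eta (mul_y f) = mul_y (mul_eta f)" "mul_eta (mul_theta f) = - mul_theta (mul_eta f)"
  "mul_theta (mul_theta f) = 0" "mul_eta (mul_eta f) = 0"
  by (rule superpoly_eqI; simp add: coefs ksign_def)+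

lemma d_d_comm:
  "d_y (d_x f) = d_x (d_y f)" "d_theta (d_x f) = d_x (d_theta f)"
  "d_eta (d_x f) = d_x (d_eta f)" "d_theta (d_y f) = d_y (d_theta f)"
  "d_eta (d_y f) = d_y (d_eta f)" "d_eta (d_theta f) = - d_theta (d_eta f)"
  "d_theta (d_theta f) = 0" "d_eta (d_eta f) = 0"
  by (rule superpoly_eqI; simp add: coefs ksign_def)+

lemma d_mul_comm:
  "d_x (mul_y f) = mul_y (d_x f)" "d_x (mul_theta f) = mul_theta (d_x f)"
  "d_x (mul_eta f) = mul_eta (d_x f)" "d_y (mul_x f) = mul_x (d_y f)"
  "d_y (mul_theta f) = mul_theta (d_y f)" "d_y (mul_eta f) = mul_eta (d_y f)"
  "d_theta (mul_x f) = mul_x (d_theta f)" "d_theta (mul_y f) = mul_y (d_theta f)"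
  "d_theta (mul_eta f) = - mul_eta (d_theta f)" "d_eta (mul_x f) = mul_x (d_eta f)"
  "d_eta (mul_y f) = mul_y (d_eta f)" "d_eta (mul_theta f) = - mul_theta (d_eta f)"
  by (rule superpoly_eqI; simp add: coefs ksign_def)+

text \<open>Apart from linearity, each rule pushes a derivative to the right past a multiplication
  or sorts operators of one kind, so rewriting brings composites to a common form in which they can
  be compared.\<close>

lemmas normal_order = op_linear weyl_clifford mul_mul_comm d_d_comm d_mul_comm

section \<open>The representation property\<close>

lemma pi_basis_linear:
  "pi_basis \<alpha> lam b (f + g) = pi_basis \<alpha> lam b f + pi_basis \<alpha> lam b g"
  "pi_basis \<alpha> lam b (k *\<^sub>p f) = k *\<^sub>p pi_basis \<alpha> lam b f"
  by (cases b rule: D21_basis_cases; simp add: op_linear Let_def;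
      simp add: poly_mapping_eq_iff fun_eq_iff lookup_add lookup_minus algebra_simps)+

lemma pi_rep_add_right: "pi_rep \<alpha> lam u (f + g) = pi_rep \<alpha> lam u f + pi_rep \<alpha> lam u g"
  by (simp add: pi_rep_def pi_basis_linear superpoly.scale_right_distrib sum.distrib)

lemma pi_rep_scale_right: "pi_rep \<alpha> lam u (k *\<^sub>p f) = k *\<^sub>p pi_rep \<alpha> lam u f"
  by (simp add: pi_rep_def pi_basis_linear superpoly.scale_sum_right mult.commute)

lemma pi_rep_add_left: "pi_rep \<alpha> lam (u + v) f = pi_rep \<alpha> lam u f + pi_rep \<alpha> lam v f"
  by (simp add: pi_rep_def superpoly.scale_left_distrib sum.distrib)

lemma pi_rep_scale_left: "pi_rep \<alpha> lam (k *s u) f = k *\<^sub>p pi_rep \<alpha> lam u f"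
  by (simp add: pi_rep_def superpoly.scale_sum_right)

lemma pi_rep_zero: "pi_rep \<alpha> lam 0 f = 0" "pi_rep \<alpha> lam u 0 = 0"
  using pi_rep_scale_left[of \<alpha> lam 0 0 f] pi_rep_scale_right[of \<alpha> lam u 0 0] by simp_all

lemma pi_rep_minus_left: "pi_rep \<alpha> lam (- u) f = - pi_rep \<alpha> lam u f"
  using pi_rep_scale_left[of \<alpha> lam "-1" u f] by simp

lemma pi_rep_diff_left: "pi_rep \<alpha> lam (u - v) f = pi_rep \<alpha> lam u f - pi_rep \<alpha> lam v f"
  using pi_rep_add_left[of \<alpha> lam u "- v" f] by (simp add: pi_rep_minus_left)

lemma pi_rep_basis_vec: "pi_rep \<alpha> lam (basis_vec b) f = pi_basis \<alpha> lam b f"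
proof -
  have "pi_rep \<alpha> lam (basis_vec b) f = (\<Sum>i\<in>UNIV. if i = b then pi_basis \<alpha> lam i f else 0)"
    unfolding pi_rep_def by (intro sum.cong refl) (auto simp: axis_def)
  then show ?thesis by (simp add: sum.delta)
qed

lemmas pi_rep_lin = pi_rep_add_left pi_rep_add_right pi_rep_scale_left pi_rep_scale_right
  pi_rep_zero pi_rep_minus_left pi_rep_diff_left pi_rep_basis_vec

text \<open>Both sides are brought to the normal order $x, y, \theta, \eta, \partial_x, \partial_y,
  \partial_\theta, \partial_\eta$; writing \<open>lam = \<alpha> * \<mu>\<close> then leaves identities polynomial in
  \<open>\<alpha>\<close> and \<open>\<mu>\<close>.\<close>

lemma pi_basis_bracket:
  assumes "\<alpha> \<noteq> 0"
  shows "pi_rep \<alpha> lam (D21_bracket_basis \<alpha> a b) f =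
     pi_basis \<alpha> lam a (pi_basis \<alpha> lam b f)
     - ksign (odd_basis a \<and> odd_basis b) *\<^sub>p pi_basis \<alpha> lam b (pi_basis \<alpha> lam a f)"
proof -
  obtain \<mu> where lam: "lam = \<alpha> * \<mu>" using assms by (metis nonzero_mult_div_cancel_left times_divide_eq_right)
  show ?thesis
    using assms
    by (cases a rule: D21_basis_cases; cases b rule: D21_basis_cases;
      simp add: pi_rep_lin Let_def ksign_def normal_order lam;
      simp add: poly_mapping_eq_iff fun_eq_iff lookup_add lookup_minus field_simps power2_eq_square)
qed

section \<open>Parity and the axioms of a super representation\<close>

lemma superpoly_part_iff:
  "f \<in> superpoly_part p \<longleftrightarrow>
     (\<forall>a b. if p then coef f (a, b, False, False) = 0 \<and> coef f (a, b, True, True) = 0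
            else coef f (a, b, False, True) = 0 \<and> coef f (a, b, True, False) = 0)"
  (is "_ \<longleftrightarrow> ?R")
proof -
  have "f \<in> superpoly_part p \<longleftrightarrow> (\<forall>a b c d. coef f (a, b, c, d) \<noteq> 0 \<longrightarrow> (c \<noteq> d) = p)"
    by (simp add: superpoly_part_def in_keys_iff Ball_def split_paired_All del: not_all)
  also have "\<dots> \<longleftrightarrow> ?R"
    by (cases p; simp add: all_bool_eq; blast)
  finally show ?thesis .
qed

lemma superpoly_part_subspace: "superpoly.subspace (superpoly_part p)"
  by (rule superpoly.subspaceI) (simp_all add: superpoly_part_iff lookup_add)

lemma pi_basis_parity:
  assumes "f \<in> superpoly_part p"
  shows "pi_basis \<alpha> lam b f \<in> superpoly_part (odd_basis b \<noteq> p)"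
  using assms unfolding superpoly_part_iff
  by (cases p; cases b rule: D21_basis_cases) (simp_all add: coefs Let_def)

text \<open>The projection onto one homogeneous part along the other; it provides both the
  decomposition of the space and the gradedness test for submodules.\<close>

definition parity_part :: "bool \<Rightarrow> superpoly \<Rightarrow> superpoly" where
  "parity_part p = lin_ext (\<lambda>(a, b, c, d). if (c \<noteq> d) = p then Poly_Mapping.single (a, b, c, d) 1 else 0)"

lemma coef_parity_part:
  "coef (parity_part p f) (a, b, c, d) = (if (c \<noteq> d) = p then coef f (a, b, c, d) else 0)"
  unfolding parity_part_def
  by (subst coef_lin_ext_unique[of "(a, b, c, d)"])
    (auto simp: lookup_single when_def split: if_splits)

lemma parity_part_in: "parity_part p f \<in> superpoly_part p"
  by (simp add: superpoly_part_iff coef_parity_part)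

lemma parity_part_sum: "f = parity_part False f + parity_part True f"
  by (rule superpoly_eqI) (simp add: lookup_add coef_parity_part)

lemma superpoly_super_vector_space: "super_vector_space (*\<^sub>p) superpoly_part"
proof -
  have "f = 0" if "f \<in> superpoly_part False" "f \<in> superpoly_part True" for f
  proof (rule superpoly_eqI)
    fix a b c d show "coef f (a, b, c, d) = coef 0 (a, b, c, d)"
      using that by (cases c; cases d) (simp_all add: superpoly_part_iff)
  qed
  moreover have "0 \<in> superpoly_part p" for p
    by (simp add: superpoly_part_iff)
  ultimately have "superpoly_part False \<inter> superpoly_part True = {0}"
    by blast
  then show ?thesis
    unfolding super_vector_space_def
    using superpoly_part_subspace superpoly.vector_space_axioms parity_part_in parity_part_sum by blast
qed

lemma pi_rep_parity:
  assumes "u \<in> D21_part p" "f \<in> superpoly_part q"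
  shows "pi_rep \<alpha> lam u f \<in> superpoly_part (p \<noteq> q)"
  using assms(1)
proof (induction u rule: D21_induct)
  case (basis b)
  then show ?case
    using pi_basis_parity[OF assms(2), of \<alpha> lam b] by (simp only: pi_rep_basis_vec)
qed (simp_all add: pi_rep_lin superpoly.subspace_0 superpoly.subspace_add superpoly.subspace_scale
    superpoly_part_subspace)

text \<open>Both sides are bilinear in \<open>u\<close> and \<open>v\<close>, and the sign is
  constant on homogeneous parts, so the basis case \<open>pi_basis_bracket\<close> extends.\<close>

lemma pi_rep_bracket:
  assumes "\<alpha> \<noteq> 0" "u \<in> D21_part p" "v \<in> D21_part q"
  shows "pi_rep \<alpha> lam (D21_bracket \<alpha> u v) f =
     pi_rep \<alpha> lam u (pi_rep \<alpha> lam v f) - ksign (p \<and> q) *\<^sub>p pi_rep \<alpha> lam v (pi_rep \<alpha> lam u f)"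
  using assms(2)
proof (induction u rule: D21_induct)
  case (basis i)
  from assms(3) show ?case
  proof (induction v rule: D21_induct)
    case (basis j)
    then show ?case
      using pi_basis_bracket[OF assms(1), of lam i j f] \<open>odd_basis i = p\<close>
      by (simp add: D21_lin pi_rep_basis_vec)
  qed (simp_all add: D21_lin pi_rep_lin superpoly.scale_right_distrib superpoly.scale_right_diff_distrib mult.commute)
qed (simp_all add: D21_lin pi_rep_lin superpoly.scale_right_distrib superpoly.scale_right_diff_distrib mult.commute)

lemma pi_rep_super_representation:
  assumes "\<alpha> \<noteq> 0"
  shows "super_representation (*s) D21_part (D21_bracket \<alpha>) (*\<^sub>p) superpoly_part (pi_rep \<alpha> lam)"
proof -
  have "Vector_Spaces.linear (*\<^sub>p) (*\<^sub>p) (pi_rep \<alpha> lam u)" for u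
    by unfold_locales (simp_all add: pi_rep_add_right pi_rep_scale_right)
  moreover have "Vector_Spaces.linear (*s) (*\<^sub>p) (\<lambda>u. pi_rep \<alpha> lam u f)" for f
    by unfold_locales (simp_all add: pi_rep_add_left pi_rep_scale_left)
  ultimately show ?thesis
    unfolding super_representation_def
    using D21_lie_superalgebra superpoly_super_vector_space pi_rep_parity pi_rep_bracket[OF assms]
    by blast
qed

section \<open>Submodules\<close>

abbreviation pi_submodule :: "complex \<Rightarrow> complex \<Rightarrow> superpoly set \<Rightarrow> bool" where
  "pi_submodule \<alpha> lam \<equiv> graded_submodule (*\<^sub>p) superpoly_part (pi_rep \<alpha> lam)"

lemma pi_submodule_subspace: "pi_submodule \<alpha> lam W \<Longrightarrow> superpoly.subspace W"
  by (simp add: graded_submodule_def)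

lemma pi_submodule_basis: "pi_submodule \<alpha> lam W \<Longrightarrow> f \<in> W \<Longrightarrow> pi_basis \<alpha> lam b f \<in> W"
  unfolding graded_submodule_def by (metis pi_rep_basis_vec)

text \<open>Every \<open>pi_rep\<close> operator is a combination of the 17 basis operators, and
  stability under the parity projections supplies homogeneous components inside
  \<open>W\<close>.\<close>

lemma pi_submoduleI:
  assumes sub: "superpoly.subspace W"
    and basis: "\<And>b f. f \<in> W \<Longrightarrow> pi_basis \<alpha> lam b f \<in> W"
    and part: "\<And>p f. f \<in> W \<Longrightarrow> parity_part p f \<in> W"
  shows "pi_submodule \<alpha> lam W"
proof -
  have "pi_rep \<alpha> lam u f \<in> W" if "f \<in> W" for u f
    unfolding pi_rep_def using that basis sub
    by (intro superpoly.subspace_sum superpoly.subspace_scale)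
  moreover have "\<exists>f0 \<in> W \<inter> superpoly_part False. \<exists>f1 \<in> W \<inter> superpoly_part True. f = f0 + f1"
    if "f \<in> W" for f
    using that part parity_part_in parity_part_sum by (metis IntI)
  ultimately show ?thesis using sub by (simp add: graded_submodule_def)
qed

section \<open>Constants inside a submodule\<close>

abbreviation vacuum :: monomial where
  "vacuum \<equiv> (0, 0, False, False)"

abbreviation monom :: "monomial \<Rightarrow> superpoly" where
  "monom m \<equiv> Poly_Mapping.single m 1"

lemma mul_monom:
  "mul_x (monom (a, b, c, d)) = monom (Suc a, b, c, d)"
  "mul_y (monom (a, b, c, d)) = monom (a, Suc b, c, d)"
  "mul_theta (monom (a, b, False, d)) = monom (a, b, True, d)"
  "mul_eta (monom (a, b, False, False)) = monom (a, b, False, True)"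
  by (rule superpoly_eqI; auto simp: coefs lookup_single when_def ksign_def)+

lemma vacuum_generates:
  assumes W: "pi_submodule \<alpha> lam W" and "monom vacuum \<in> W"
  shows "W = UNIV"
proof -
  note step = pi_submodule_basis[OF W]
  have "monom (0, b, False, False) \<in> W" for b
  proof (induction b)
    case (Suc b) then show ?case using step[of _ "Xe D2 Minus"] by (fastforce simp: mul_monom)
  qed (use assms in simp)
  then have "monom (a, b, False, False) \<in> W" for a b
  proof (induction a)
    case (Suc a) then show ?case using step[of _ "Xe D3 Minus"] by (fastforce simp: mul_monom)
  qed simp
  \<comment> \<open>Multiplying by eta before theta avoids the sign in
    \<open>mul_eta\<close>.\<close>
  then have "monom (a, b, False, d) \<in> W" for a b d
    using step[of "monom (a, b, False, False)" "Xo Minus Minus Minus"] by (cases d) (simp_all add: mul_monom)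
  then have "monom (a, b, c, d) \<in> W" for a b c d
    using step[of "monom (a, b, False, d)" "Xo Plus Minus Minus"] by (cases c) (simp_all add: mul_monom)
  then have monom: "monom m \<in> W" for m
    by (cases m) auto
  have "f \<in> W" for f
  proof -
    have "f = (\<Sum>m\<in>Poly_Mapping.keys f. coef f m *\<^sub>p monom m)"
      by (rule poly_mapping_eqI)
        (simp add: lookup_sum lookup_single when_def in_keys_iff if_distrib cong: if_cong)
    moreover have "(\<Sum>m\<in>Poly_Mapping.keys f. coef f m *\<^sub>p monom m) \<in> W"
      using monom pi_submodule_subspace[OF W]
      by (intro superpoly.subspace_sum superpoly.subspace_scale)
    ultimately show ?thesis by simp
  qed
  then show ?thesis by blast
qed

text \<open>Monomials are weight vectors. The subtracted natural number is 0 for \<open>H D2\<close>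
  only if b, c, d all vanish, and for \<open>H D3\<close> only if a, c, d do; together they separate
  the vacuum from all other monomials.\<close>

lemma coef_Cartan:
  "coef (pi_basis \<alpha> lam (H D2) f) (a, b, c, d) =
     (lam - of_nat (2 * b + of_bool c + of_bool d)) * coef f (a, b, c, d)"
  "coef (pi_basis \<alpha> lam (H D3) f) (a, b, c, d) =
     (lam / \<alpha> - of_nat (2 * a + of_bool c + of_bool d)) * coef f (a, b, c, d)"
  by (simp_all add: coefs ksign_def algebra_simps of_nat_diff)

text \<open>The weight of the vacuum has multiplicity one, so an element of minimal support among those
  with a vacuum component is a multiple of the vacuum.\<close>

lemma vacuum_in_submodule:
  assumes W: "pi_submodule \<alpha> lam W" and "f \<in> W" "coef f vacuum \<noteq> 0"
  shows "monom vacuum \<in> W"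
proof -
  note sub = pi_submodule_subspace[OF W]
  obtain g where g: "g \<in> W" "coef g vacuum \<noteq> 0"
    and min: "\<And>h. h \<in> W \<Longrightarrow> coef h vacuum \<noteq> 0 \<Longrightarrow>
      card (Poly_Mapping.keys g) \<le> card (Poly_Mapping.keys h)"
    using ex_has_least_nat[of "\<lambda>f. f \<in> W \<and> coef f vacuum \<noteq> 0" f "\<lambda>f. card (Poly_Mapping.keys f)"] assms
    by blast
  have reduce: "coef g m = 0"
    if \<mu>: "\<And>m. coef (pi_basis \<alpha> lam b g) m = \<mu> m * coef g m" and m: "\<mu> m \<noteq> \<mu> vacuum" for b \<mu> m
  proof (rule ccontr)
    assume nz: "coef g m \<noteq> 0"
    \<comment> \<open>Subtracting the eigenvalue at \<open>m\<close> deletes \<open>m\<close> from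
      the support, adds nothing to it, and keeps the vacuum coefficient nonzero because the
      eigenvalues differ; this contradicts minimality.\<close>
    define h where "h = pi_basis \<alpha> lam b g - \<mu> m *\<^sub>p g"
    have h: "coef h k = (\<mu> k - \<mu> m) * coef g k" for k
      by (simp add: h_def lookup_minus \<mu> algebra_simps)
    have "h \<in> W"
      unfolding h_def using g(1) pi_submodule_basis[OF W]
      by (intro superpoly.subspace_diff superpoly.subspace_scale sub)
    moreover have "coef h vacuum \<noteq> 0" using h g m by simp
    moreover have "Poly_Mapping.keys h \<subset> Poly_Mapping.keys g"
    proof (rule psubsetI)
      show "Poly_Mapping.keys h \<subseteq> Poly_Mapping.keys g" using h by (auto simp: in_keys_iff)
      have "m \<in> Poly_Mapping.keys g" "m \<notin> Poly_Mapping.keys h" using h nz by (auto simp: in_keys_iff)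
      then show "Poly_Mapping.keys h \<noteq> Poly_Mapping.keys g" by blast
    qed
    ultimately show False
      using min psubset_card_mono[OF finite_keys[of g]] by (meson leD)
  qed
  have "g = coef g vacuum *\<^sub>p monom vacuum"
  proof (rule superpoly_eqI)
    fix a b c d
    have "coef g (a, b, c, d) = 0" if "b \<noteq> 0 \<or> c \<or> d"
      by (rule reduce[of "H D2" "\<lambda>(a, b, c, d). lam - of_nat (2 * b + of_bool c + of_bool d)"])
        (use that coef_Cartan(1) in \<open>auto simp del: of_nat_add of_nat_mult simp: of_nat_eq_0_iff\<close>)
    moreover have "coef g (a, b, c, d) = 0" if "a \<noteq> 0"
      by (rule reduce[of "H D3" "\<lambda>(a, b, c, d). lam / \<alpha> - of_nat (2 * a + of_bool c + of_bool d)"])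
        (use that coef_Cartan(2) in \<open>auto simp del: of_nat_add of_nat_mult simp: of_nat_eq_0_iff\<close>)
    ultimately show "coef g (a, b, c, d) = coef (coef g vacuum *\<^sub>p monom vacuum) (a, b, c, d)"
      by (auto simp: lookup_single when_def)
  qed
  then have "monom vacuum = inverse (coef g vacuum) *\<^sub>p g"
    using g(2) by (metis superpoly.scale_scale superpoly.scale_one left_inverse)
  then show ?thesis using superpoly.subspace_scale[OF sub g(1)] by simp
qed

section \<open>Indecomposability for every lam\<close>

lemma pi_rep_indecomposable:
  assumes "\<alpha> \<noteq> 0"
  shows "indecomposable_rep (*s) D21_part (D21_bracket \<alpha>) (*\<^sub>p) superpoly_part (pi_rep \<alpha> lam)"
proof -
  have "W1 = {0} \<or> W2 = {0}"
    if W: "pi_submodule \<alpha> lam W1" "pi_submodule \<alpha> lam W2" and inter: "W1 \<inter> W2 = {0}"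
      and sum: "\<forall>f. \<exists>w1\<in>W1. \<exists>w2\<in>W2. f = w1 + w2" for W1 W2
  proof -
    obtain w1 w2 where "w1 \<in> W1" "w2 \<in> W2" and vac: "monom vacuum = w1 + w2"
      using sum by blast
    have "coef w1 vacuum + coef w2 vacuum = 1"
      using arg_cong[OF vac, of "\<lambda>f. coef f vacuum"] by (simp add: lookup_add)
    then have "coef w1 vacuum \<noteq> 0 \<or> coef w2 vacuum \<noteq> 0" by auto
    then have "W1 = UNIV \<or> W2 = UNIV"
      using vacuum_generates vacuum_in_submodule W \<open>w1 \<in> W1\<close> \<open>w2 \<in> W2\<close> by metis
    with inter show ?thesis by auto
  qed
  moreover have "monom vacuum \<noteq> 0" by (metis lookup_single_eq lookup_zero zero_neq_one)
  ultimately show ?thesis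
    unfolding indecomposable_rep_def using pi_rep_super_representation[OF assms] by blast
qed

section \<open>Reaching the constant term when lam and lam / \<alpha> are not natural\<close>

section \<open>Irreducibility\<close>

lemma not_Nats_neq_of_nat: "(z :: complex) \<notin> \<nat> \<Longrightarrow> z \<noteq> of_nat n"
  by auto

lemma vacuum_component:
  assumes "\<alpha> \<noteq> 0" "lam \<notin> \<nat>" "lam / \<alpha> \<notin> \<nat>"
    and W: "pi_submodule \<alpha> lam W" and f: "f \<in> W" "f \<noteq> 0"
  shows "\<exists>g\<in>W. coef g vacuum \<noteq> 0"
proof -
  \<comment> \<open>Only one nonzero coefficient at the vacuum is wanted, so it suffices to trace
    which monomials occur in some element of \<open>W\<close>, where the element may change at each
    move.\<close>
  define R where "R = {m. \<exists>f\<in>W. coef f m \<noteq> 0}"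
  have step: "m \<in> R" if "f \<in> W" "coef (pi_basis \<alpha> lam b f) m \<noteq> 0" for f b m
    using that pi_submodule_basis[OF W] by (auto simp: R_def)
  have lower_x: "(a, b, c, d) \<in> R" if "(Suc a, b, c, d) \<in> R" "c \<noteq> d" for a b c d
  proof -
    from that(1) obtain f where f: "f \<in> W" "coef f (Suc a, b, c, d) \<noteq> 0" by (auto simp: R_def)
    \<comment> \<open>With exactly one odd variable the term with both odd derivatives contributes
      nothing, and that variable shifts the factor from lam / \<alpha> - a to lam / \<alpha> - (a +
      1).\<close>
    have "coef (pi_basis \<alpha> lam (Xe D3 Plus) f) (a, b, c, d)
        = (lam / \<alpha> - of_nat (Suc a)) * of_nat (Suc a) * coef f (Suc a, b, c, d)"
      using \<open>c \<noteq> d\<close> by (cases c; cases d) (simp_all add: coefs Let_def ksign_def algebra_simps of_nat_diff)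
    then show ?thesis
      using f step[of f "Xe D3 Plus" "(a, b, c, d)"] not_Nats_neq_of_nat[OF assms(3), of "Suc a"]
      by (simp del: of_nat_Suc)
  qed
  have lower_y: "(a, b, c, d) \<in> R" if "(a, Suc b, c, d) \<in> R" "c \<noteq> d" for a b c d
  proof -
    from that(1) obtain f where f: "f \<in> W" "coef f (a, Suc b, c, d) \<noteq> 0" by (auto simp: R_def)
    have "coef (pi_basis \<alpha> lam (Xe D2 Plus) f) (a, b, c, d)
        = (lam - of_nat (Suc b)) * of_nat (Suc b) * coef f (a, Suc b, c, d)"
      using \<open>c \<noteq> d\<close> by (cases c; cases d) (simp_all add: coefs Let_def ksign_def algebra_simps of_nat_diff)
    then show ?thesis
      using f step[of f "Xe D2 Plus" "(a, b, c, d)"] not_Nats_neq_of_nat[OF assms(2), of "Suc b"]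
      by (simp del: of_nat_Suc)
  qed
  have odd: "vacuum \<in> R" if "(a, b, c, d) \<in> R" "c \<noteq> d" for a b c d
  proof -
    have "(0, b, c, d) \<in> R" using that by (induction a) (auto intro: lower_x)
    then have "(0, 0, c, d) \<in> R" using that(2) by (induction b) (auto intro: lower_y)
    then obtain f where f: "f \<in> W" "coef f (0, 0, c, d) \<noteq> 0" by (auto simp: R_def)
    \<comment> \<open>Theta reaches the constant through \<open>Xo Minus Plus Plus\<close> with
      factor -lam, eta through \<open>Xo Plus Plus Plus\<close> with factor lam.\<close>
    have "lam \<noteq> 0" using assms(2) by auto
    then show ?thesis
      using f step[of f "Xo Minus Plus Plus" vacuum] step[of f "Xo Plus Plus Plus" vacuum] that(2)
      by (cases c; cases d) (simp_all add: coefs Let_def ksign_def)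
  qed
  obtain a b c d where m: "coef f (a, b, c, d) \<noteq> 0"
    using f(2) by (metis superpoly_eqI lookup_zero)
  have "vacuum \<in> R"
  proof (cases "c = d")
    case False
    have "(a, b, c, d) \<in> R" using m f(1) by (auto simp: R_def)
    then show ?thesis using odd False by simp
  next
    case True
    show ?thesis
    proof (rule ccontr)
      assume no: "vacuum \<notin> R"
      \<comment> \<open>A nonzero coefficient at an eta monomial would lead to the vacuum by
        \<open>odd\<close>.\<close>
      have zero: "coef (pi_basis \<alpha> lam b f) (i, j, False, True) = 0" for b i j
        using odd[of i j False True] step[OF f(1)] no by blast
      have pair: "coef f (Suc i, Suc j, False, False) = 0 \<and> coef f (i, j, True, True) = 0" for i j
      proof -
        define p where "p = coef f (Suc i, Suc j, False, False)"
        define q where "q = coef f (i, j, True, True)"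
        \<comment> \<open>The monomials behind \<open>p\<close> and \<open>q\<close> have the same
          weight, so each of the three odd root vectors used here sends both to multiples of one eta
          monomial and links \<open>p\<close> with \<open>q\<close>.\<close>
        have 1: "- (of_nat (Suc i) * p) - q = 0"
          using zero[of "Xo Minus Minus Plus" i "Suc j"] by (simp add: coefs p_def q_def ksign_def)
        have 2: "- (of_nat (Suc j) * p) - \<alpha> * q = 0"
          using zero[of "Xo Minus Plus Minus" "Suc i" j] by (simp add: coefs p_def q_def ksign_def)
        have 3: "(- lam + \<alpha> * of_nat (Suc i) + of_nat (Suc j)) * q
            + of_nat (Suc i) * of_nat (Suc j) * p = 0"
          using zero[of "Xo Minus Plus Plus" i j]
          by (cases i; cases j) (simp_all add: coefs Let_def p_def q_def ksign_def algebra_simps)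
        \<comment> \<open>Inserting relation 2 into 3 cancels the multiples of \<alpha> and leaves
          the factor \<open>of_nat (Suc j) - lam\<close>, nonzero since lam is not natural.\<close>
        have "of_nat (Suc i) * of_nat (Suc j) * p = - \<alpha> * of_nat (Suc i) * q"
          using 2 by algebra
        with 3 have 4: "(of_nat (Suc j) - lam) * q = 0" by algebra
        then have "q = 0" using not_Nats_neq_of_nat[OF assms(2), of "Suc j"] by auto
        with 1 have "p = 0" by (simp del: of_nat_Suc)
        with \<open>q = 0\<close> show ?thesis by (simp add: p_def q_def)
      qed
      \<comment> \<open>Pure powers of x or of y have no theta eta partner of the same weight, so a
        single equation kills each of their coefficients.\<close>
      have "coef f (Suc i, 0, False, False) = 0" for i
        using zero[of "Xo Minus Minus Plus" i 0] by (simp add: coefs ksign_def del: of_nat_Suc)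
      moreover have "coef f (0, Suc j, False, False) = 0" for j
        using zero[of "Xo Minus Plus Minus" 0 j] by (simp add: coefs ksign_def del: of_nat_Suc)
      moreover have "coef f vacuum = 0" using no f(1) by (auto simp: R_def)
      ultimately show False
        using m pair True by (cases a; cases b; cases c) auto
    qed
  qed
  then show ?thesis by (simp add: R_def)
qed

lemma pi_rep_irreducible:
  assumes "\<alpha> \<noteq> 0" "lam \<notin> \<nat>" "lam / \<alpha> \<notin> \<nat>"
  shows "irreducible_rep (*s) D21_part (D21_bracket \<alpha>) (*\<^sub>p) superpoly_part (pi_rep \<alpha> lam)"
proof -
  have "W = {0} \<or> W = UNIV" if W: "pi_submodule \<alpha> lam W" for W
  proof (cases "\<exists>f\<in>W. f \<noteq> 0")
    case True
    then show ?thesis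
      using vacuum_component[OF assms W] vacuum_in_submodule[OF W] vacuum_generates[OF W] by blast
  next
    case False
    then show ?thesis using superpoly.subspace_0[OF pi_submodule_subspace[OF W]] by blast
  qed
  moreover have "monom vacuum \<noteq> 0" by (metis lookup_single_eq lookup_zero zero_neq_one)
  ultimately show ?thesis
    unfolding irreducible_rep_def using pi_rep_super_representation[OF assms(1)] by blast
qed

section \<open>Proper submodules at natural values of lam / \<alpha> or lam\<close>

section \<open>Reducibility\<close>

lemma not_irreducibleI:
  assumes "pi_submodule \<alpha> lam W" "f \<in> W" "f \<noteq> 0" "g \<notin> W"
  shows "\<not> irreducible_rep (*s) D21_part (D21_bracket \<alpha>) (*\<^sub>p) superpoly_part (pi_rep \<alpha> lam)"
  using assms unfolding irreducible_rep_def by blast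

text \<open>x^a y^b theta eta has the weight of x^(a+1) y^(b+1), hence the bounds on
  \<open>Suc a\<close>. The last clause ties the two coefficients of a boundary term together; x^n
  has no theta eta partner and is excluded. For n = 0 only the vanishing constant term
  remains.\<close>

definition proper_submodule_x :: "nat \<Rightarrow> superpoly set" where
  "proper_submodule_x n = {f.
     (\<forall>a b. a < n \<longrightarrow> coef f (a, b, False, False) = 0 \<and> coef f (a, b, False, True) = 0
                   \<and> coef f (a, b, True, False) = 0) \<and>
     (\<forall>a b. Suc a < n \<longrightarrow> coef f (a, b, True, True) = 0) \<and>
     coef f (n, 0, False, False) = 0 \<and>
     (\<forall>a b. Suc a = n \<longrightarrow> coef f (a, b, True, True) = - of_nat n * coef f (n, Suc b, False, False))}"

text \<open>Every operator lowers the exponent of x by at most one, so for n = k + 1 all output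
  below exponent k - 1 vanishes outright. At k - 1 and above, vanishing factors such as lam /
  \<alpha> - n and the boundary relation do the work.\<close>

lemma proper_submodule_x_basis:
  assumes "\<alpha> \<noteq> 0" "lam / \<alpha> = of_nat n" "f \<in> proper_submodule_x n"
  shows "pi_basis \<alpha> lam b f \<in> proper_submodule_x n"
proof -
  have lam: "lam = \<alpha> * of_nat n" using assms(1,2) by (simp add: field_simps)
  show ?thesis
  proof (cases n)
    \<comment> \<open>Here lam and lam / \<alpha> are both 0, so no operator produces a constant
      term from an element without one.\<close>
    case 0
    with assms(3) show ?thesis
      unfolding proper_submodule_x_def
      by (cases b rule: D21_basis_cases) (simp_all add: coefs Let_def ksign_def lam 0)
  next
    case (Suc k)
    have z: "coef f (a, b, False, False) = 0" "coef f (a, b, False, True) = 0"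
       "coef f (a, b, True, False) = 0" if "a < Suc k" for a b
      using that assms(3) Suc by (auto simp: proper_submodule_x_def)
    have z': "coef f (a, b, True, True) = 0" if "a < k" for a b
      using that assms(3) Suc by (auto simp: proper_submodule_x_def)
    have z1: "coef f (Suc k, 0, False, False) = 0"
       "coef f (k, b, True, True) = - of_nat (Suc k) * coef f (Suc k, Suc b, False, False)" for b
      using assms(3) Suc by (auto simp: proper_submodule_x_def)
    have lt: "a < k \<Longrightarrow> a < Suc k" "a < k \<Longrightarrow> Suc a < Suc k" "a < k \<Longrightarrow> a - Suc 0 < k"
       "a < Suc k \<Longrightarrow> a - Suc 0 < Suc k" for a
      by auto
    have low: "coef (pi_basis \<alpha> lam b f) (i, j, c, d) = 0" if "Suc i < k" for i j c d
      using that
      by (cases b rule: D21_basis_cases; cases c; cases d)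
        (simp_all add: coefs Let_def ksign_def z z' z1 lt)
    have lamk: "lam / \<alpha> = 1 + of_nat k" "lam = \<alpha> + \<alpha> * of_nat k"
      using assms(2) lam Suc by (simp_all add: algebra_simps)
    \<comment> \<open>The x-derivative now meets theta eta coefficients at exponent k, which may be
      nonzero; in \<open>Xe D3 Plus\<close> they carry the factor n - (i + 2) = 0.\<close>
    have mid: "coef (pi_basis \<alpha> lam b f) (i, j, c, d) = 0" if i: "Suc i = k" for i j c d
    proof -
      have k: "of_nat k = 1 + (of_nat i :: complex)" using i by auto
      have ik: "i < k" "i < Suc k" "i - Suc 0 < k" "i - Suc 0 < Suc k" using i by auto
      show ?thesis
        by (cases b rule: D21_basis_cases; cases c; cases d; cases j;
          simp add: coefs Let_def ksign_def i ik z z' z1 lamk(1); (simp add: i ik z z' z1 lamk(2) k algebra_simps)?)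
          (use i in auto)
    qed
    \<comment> \<open>Contributions from x^(k+1) y^(j+1) and x^k y^j theta eta cancel by the
      boundary relation. Multiplication by y has no source at j = 0, where the vanishing coefficient
      of x^n takes over.\<close>
    have top: "coef (pi_basis \<alpha> lam b f) (k, j, False, False) = 0"
      "coef (pi_basis \<alpha> lam b f) (k, j, False, True) = 0"
      "coef (pi_basis \<alpha> lam b f) (k, j, True, False) = 0" for j
      by (cases b rule: D21_basis_cases; cases j;
        simp add: coefs Let_def ksign_def z z' z1 lamk(1); (simp add: z z' z1 lamk(2) algebra_simps)?)+
    have top': "coef (pi_basis \<alpha> lam b f) (Suc k, 0, False, False) = 0"
      by (cases b rule: D21_basis_cases;
        simp add: coefs Let_def ksign_def z z' z1 lamk(1); (simp add: z z' z1 lamk(2) algebra_simps)?)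
    \<comment> \<open>For \<open>Xe D3 Plus\<close> both sides reduce to -(k + 1) times the theta
      eta coefficient at x-exponent k + 1.\<close>
    have top'': "coef (pi_basis \<alpha> lam b f) (k, j, True, True) =
        - of_nat (Suc k) * coef (pi_basis \<alpha> lam b f) (Suc k, Suc j, False, False)" for j
      by (cases b rule: D21_basis_cases; cases j;
        simp add: coefs Let_def ksign_def z z' z1 lamk(1); (simp add: z z' z1 lamk(2) algebra_simps)?)
    show ?thesis
      unfolding proper_submodule_x_def Suc
      using low mid top top' top'' by (auto simp: less_Suc_eq) (metis Suc_lessI)+
  qed
qed

lemma proper_submodule_x_submodule:
  assumes "\<alpha> \<noteq> 0" "lam / \<alpha> = of_nat n"
  shows "pi_submodule \<alpha> lam (proper_submodule_x n)"
proof (rule pi_submoduleI)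
  show "superpoly.subspace (proper_submodule_x n)"
    by (rule superpoly.subspaceI) (auto simp: proper_submodule_x_def lookup_add algebra_simps)
  show "pi_basis \<alpha> lam b f \<in> proper_submodule_x n" if "f \<in> proper_submodule_x n" for b f
    using proper_submodule_x_basis[OF assms that] .
  show "parity_part p f \<in> proper_submodule_x n" if "f \<in> proper_submodule_x n" for p f
    using that by (simp add: proper_submodule_x_def coef_parity_part)
qed

lemma pi_rep_reducible_x:
  assumes "\<alpha> \<noteq> 0" "lam / \<alpha> = of_nat n"
  shows "\<not> irreducible_rep (*s) D21_part (D21_bracket \<alpha>) (*\<^sub>p) superpoly_part (pi_rep \<alpha> lam)"
proof (rule not_irreducibleI[OF proper_submodule_x_submodule[OF assms]])
  \<comment> \<open>x^(n+1) is the first pure power of x beyond the boundary; x^n itself is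
    excluded.\<close>
  show "monom (Suc n, 0, False, False) \<in> proper_submodule_x n"
    by (auto simp: proper_submodule_x_def lookup_single when_def)
  show "monom (Suc n, 0, False, False) \<noteq> 0"
    by (metis lookup_single_eq lookup_zero zero_neq_one)
  show "monom vacuum \<notin> proper_submodule_x n"
  proof
    assume "monom vacuum \<in> proper_submodule_x n"
    \<comment> \<open>For n = 0 the clause on x^n is the one about the constant term; otherwise the
      bound \<open>a < n\<close> covers it.\<close>
    then have "coef (monom vacuum) vacuum = 0"
      unfolding proper_submodule_x_def mem_Collect_eq by (cases "n = 0") blast+
    then show False by simp
  qed
qed

text \<open>The counterpart with x and y exchanged. Since X_{2 delta_2} contains \<alpha> x d_eta
  d_theta, the boundary terms it kills are \<alpha> x^a y^n - n x^(a-1) y^(n-1) theta eta, which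
  explains the factor \<alpha> in the relation.\<close>

definition proper_submodule_y :: "complex \<Rightarrow> nat \<Rightarrow> superpoly set" where
  "proper_submodule_y \<alpha> n = {f.
     (\<forall>a b. b < n \<longrightarrow> coef f (a, b, False, False) = 0 \<and> coef f (a, b, False, True) = 0
                   \<and> coef f (a, b, True, False) = 0) \<and>
     (\<forall>a b. Suc b < n \<longrightarrow> coef f (a, b, True, True) = 0) \<and>
     coef f (0, n, False, False) = 0 \<and>
     (\<forall>a b. Suc b = n \<longrightarrow>
        \<alpha> * coef f (a, b, True, True) = - of_nat n * coef f (Suc a, n, False, False))}"

text \<open>Every operator lowers the exponent of y by at most one, and \<open>Xe D2 Plus\<close>
  now supplies the factors that vanish because lam = n.\<close>

lemma proper_submodule_y_basis:
  assumes "\<alpha> \<noteq> 0" "lam = of_nat n" "f \<in> proper_submodule_y \<alpha> n"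
  shows "pi_basis \<alpha> lam b f \<in> proper_submodule_y \<alpha> n"
proof -
  show ?thesis
  proof (cases n)
    case 0
    with assms(3) show ?thesis
      unfolding proper_submodule_y_def
      by (cases b rule: D21_basis_cases) (simp_all add: coefs Let_def ksign_def assms(2) 0)
  next
    case (Suc k)
    have z: "coef f (a, b, False, False) = 0" "coef f (a, b, False, True) = 0"
       "coef f (a, b, True, False) = 0" if "b < Suc k" for a b
      using that assms(3) Suc by (auto simp: proper_submodule_y_def)
    have z': "coef f (a, b, True, True) = 0" if "b < k" for a b
      using that assms(3) Suc by (auto simp: proper_submodule_y_def)
    have z0: "coef f (0, Suc k, False, False) = 0"
      and rel: "\<alpha> * coef f (a, k, True, True) = - of_nat (Suc k) * coef f (Suc a, Suc k, False, False)" for a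
      using assms(3) Suc by (auto simp: proper_submodule_y_def)
    \<comment> \<open>With \<open>e\<close> as the free parameter the constraints become rewrite
      rules without division by \<open>\<alpha>\<close>.\<close>
    define e where "e a = coef f (Suc a, Suc k, False, False) / \<alpha>" for a
    have z1: "coef f (0, Suc k, False, False) = 0" "coef f (Suc a, Suc k, False, False) = \<alpha> * e a"
      "coef f (a, k, True, True) = - of_nat (Suc k) * e a" for a
      using z0 rel[of a] assms(1) by (simp_all add: e_def field_simps)
    have lt: "a < k \<Longrightarrow> a < Suc k" "a < k \<Longrightarrow> Suc a < Suc k" "a < k \<Longrightarrow> a - Suc 0 < k"
       "a < Suc k \<Longrightarrow> a - Suc 0 < Suc k" for a
      by auto
    have low: "coef (pi_basis \<alpha> lam b f) (j, i, c, d) = 0" if "Suc i < k" for i j c d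
      using that
      by (cases b rule: D21_basis_cases; cases c; cases d)
        (simp_all add: coefs Let_def ksign_def z z' z1 lt)
    have lamk: "lam = 1 + of_nat k"
      using assms(2) Suc by simp
    have mid: "coef (pi_basis \<alpha> lam b f) (j, i, c, d) = 0" if i: "Suc i = k" for i j c d
    proof -
      have k: "of_nat k = 1 + (of_nat i :: complex)" using i by auto
      have ik: "i < k" "i < Suc k" "i - Suc 0 < k" "i - Suc 0 < Suc k" using i by auto
      show ?thesis
        by (cases b rule: D21_basis_cases; cases c; cases d; cases j;
          simp add: coefs Let_def ksign_def i ik z z' z1 lamk; (simp add: i ik z z' z1 lamk k algebra_simps)?)
          (use i in auto)
    qed
    \<comment> \<open>The boundary contributions are opposite multiples of \<open>e\<close>. At j =
      0 multiplication by x has no source, and the vanishing coefficient of y^n is used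
      instead.\<close>
    have top: "coef (pi_basis \<alpha> lam b f) (j, k, False, False) = 0"
      "coef (pi_basis \<alpha> lam b f) (j, k, False, True) = 0"
      "coef (pi_basis \<alpha> lam b f) (j, k, True, False) = 0" for j
      by (cases b rule: D21_basis_cases; cases j;
        simp add: coefs Let_def ksign_def z z' z1 lamk; (simp add: z z' z1 lamk algebra_simps)?)+
    have top': "coef (pi_basis \<alpha> lam b f) (0, Suc k, False, False) = 0"
      by (cases b rule: D21_basis_cases;
        simp add: coefs Let_def ksign_def z z' z1 assms(1) lamk; (simp add: z z' z1 assms(1) lamk algebra_simps)?)
    have top'': "\<alpha> * coef (pi_basis \<alpha> lam b f) (j, k, True, True) =
        - of_nat (Suc k) * coef (pi_basis \<alpha> lam b f) (Suc j, Suc k, False, False)" for j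
      by (cases b rule: D21_basis_cases; cases j;
        simp add: coefs Let_def ksign_def z z' z1 assms(1) lamk; (simp add: z z' z1 assms(1) lamk algebra_simps)?;
        (simp add: assms(1) add_divide_distrib diff_divide_distrib)?)
    show ?thesis
      unfolding proper_submodule_y_def Suc
      using low mid top top' top'' by (auto simp: less_Suc_eq) (metis Suc_lessI)+
  qed
qed

lemma proper_submodule_y_submodule:
  assumes "\<alpha> \<noteq> 0" "lam = of_nat n"
  shows "pi_submodule \<alpha> lam (proper_submodule_y \<alpha> n)"
proof (rule pi_submoduleI)
  show "superpoly.subspace (proper_submodule_y \<alpha> n)"
    by (rule superpoly.subspaceI) (auto simp: proper_submodule_y_def lookup_add algebra_simps)
  show "pi_basis \<alpha> lam b f \<in> proper_submodule_y \<alpha> n" if "f \<in> proper_submodule_y \<alpha> n" for b f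
    using proper_submodule_y_basis[OF assms that] .
  show "parity_part p f \<in> proper_submodule_y \<alpha> n" if "f \<in> proper_submodule_y \<alpha> n" for p f
    using that by (simp add: proper_submodule_y_def coef_parity_part)
qed

lemma pi_rep_reducible_y:
  assumes "\<alpha> \<noteq> 0" "lam = of_nat n"
  shows "\<not> irreducible_rep (*s) D21_part (D21_bracket \<alpha>) (*\<^sub>p) superpoly_part (pi_rep \<alpha> lam)"
proof (rule not_irreducibleI[OF proper_submodule_y_submodule[OF assms]])
  show "monom (0, Suc n, False, False) \<in> proper_submodule_y \<alpha> n"
    by (auto simp: proper_submodule_y_def lookup_single when_def)
  show "monom (0, Suc n, False, False) \<noteq> 0"
    by (metis lookup_single_eq lookup_zero zero_neq_one)
  show "monom vacuum \<notin> proper_submodule_y \<alpha> n"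
  proof
    assume "monom vacuum \<in> proper_submodule_y \<alpha> n"
    then have "coef (monom vacuum) vacuum = 0"
      unfolding proper_submodule_y_def mem_Collect_eq by (cases "n = 0") blast+
    then show False by simp
  qed
qed

section \<open>The irreducibility criterion, assembled from both directions\<close>

theorem proposition5p3:
  fixes \<alpha> lam :: complex
  assumes "\<alpha> \<noteq> 0" and "\<alpha> \<noteq> - 1"
  shows "(irreducible_rep (*s) D21_part (D21_bracket \<alpha>) (*\<^sub>p) superpoly_part (pi_rep \<alpha> lam)
            \<longleftrightarrow> lam \<notin> \<nat> \<and> lam / \<alpha> \<notin> \<nat>) \<and>
         (lam \<in> \<nat> \<or> lam / \<alpha> \<in> \<nat> \<longrightarrow>
            indecomposable_rep (*s) D21_part (D21_bracket \<alpha>) (*\<^sub>p) superpoly_part (pi_rep \<alpha> lam)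
            \<and> \<not> irreducible_rep (*s) D21_part (D21_bracket \<alpha>) (*\<^sub>p) superpoly_part (pi_rep \<alpha> lam))"
proof -
  have "\<not> irreducible_rep (*s) D21_part (D21_bracket \<alpha>) (*\<^sub>p) superpoly_part (pi_rep \<alpha> lam)"
    if "lam \<in> \<nat> \<or> lam / \<alpha> \<in> \<nat>"
    using that pi_rep_reducible_x[OF assms(1)] pi_rep_reducible_y[OF assms(1)]
    by (auto elim!: Nats_cases)
  then show ?thesis
    using pi_rep_irreducible[OF assms(1)] pi_rep_indecomposable[OF assms(1)] by blast
qed

end
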